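(* Let $(Z_n)_{n\ge0}$ be a linear fractional Galton–Watson process in i.i.d. random environment (as in the context) which is supercritical, i.e. $R_\infty<\infty=R^{(-1)}_\infty$ a.s. Then for almost every realization of $\mathbf{e}$, $W_n:=\Pi_nZ_n$, $n\ge0$, is a nonnegative martingale with mean one under $\mathbf{P}$, hence converges $\mathbf{P}$-a.s. to a random variable $W_\infty$, whose conditional law is $$\mathbf{P}(W_\infty\in\cdot)=\Big(1-\frac{1}{R_\infty}\Big)\delta_0+\frac{1}{R_\infty}\,\mathrm{Exp}\Big(\frac{1}{R_\infty}\Big),$$ and in particular $W_\infty$ also has $\mathbf{P}$-mean one.
   Context: Let $(A_n,B_n)_{n\ge1}$ be i.i.d. copies of $(A,B)$ with $\mathbb{P}(A>0,B>0,A+B\ge1)=1$; $\mathbf{e}=(A_n,B_n)_{n\ge1}$. For $a,b>0$, $a+b\ge1$, $LF(a,b)$ is the distribution on $\mathbb{N}_0$ whose generating function $f$ satisfies $1/(1-f(s))=a/(1-s)+b$, $s\in[0,1)$. $(Z_n)$, $Z_0=1$: given $\mathbf{e}$, each individual of generation $k-1$ independently has offspring law $LF(A_k,B_k)$. $\mathbf{P}=\mathbb{P}(\cdot\mid\mathbf{e})$. $\Pi_0=1$, $\Pi_n=\prod_{k=1}^nA_k$, $R_\infty=\sum_{k\ge1}\Pi_{k-1}B_k$, $R^{(-1)}_\infty=\sum_{k\ge1}\Pi_k^{-1}B_k$. $\mathrm{Exp}(\lambda)$ is the exponential distribution with rate $\lambda$ (mean $1/\lambda$). *)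

theory Defs
  imports "HOL-Probability.Probability"
begin

definition LF :: "real \<Rightarrow> real \<Rightarrow> nat pmf" where
  "LF a b = (THE p. \<forall>s\<in>{0..<1}.
      1 / (1 - (\<Sum>k. pmf p k * s ^ k)) = a / (1 - s) + b)"

text \<open>Environment products: Pi_env A x n = A_1 * ... * A_n (Pi_0 = 1).
  Environments are indexed from 1 as in the paper; index 0 is unused.\<close>
definition Pi_env :: "(nat \<Rightarrow> 'e \<Rightarrow> real) \<Rightarrow> 'e \<Rightarrow> nat \<Rightarrow> real" where
  "Pi_env A x n = (\<Prod>k\<in>{1..n}. A k x)"

definition R_inf :: "(nat \<Rightarrow> 'e \<Rightarrow> real) \<Rightarrow> (nat \<Rightarrow> 'e \<Rightarrow> real) \<Rightarrow> 'e \<Rightarrow> real" where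
  "R_inf A B x = (\<Sum>k. Pi_env A x k * B (Suc k) x)"

text \<open>Quenched law P = P( . | e): a point w assigns to the pair (k,i) the number
  w (k,i) of children of the i-th individual of generation k-1; these are
  independent with law LF(A_k, B_k).\<close>
definition quenched :: "(nat \<Rightarrow> 'e \<Rightarrow> real) \<Rightarrow> (nat \<Rightarrow> 'e \<Rightarrow> real) \<Rightarrow> 'e
    \<Rightarrow> (nat \<times> nat \<Rightarrow> nat) measure" where
  "quenched A B x = PiM UNIV (\<lambda>(k, i). measure_pmf (LF (A k x) (B k x)))"

fun Zproc :: "nat \<Rightarrow> (nat \<times> nat \<Rightarrow> nat) \<Rightarrow> nat" where
  "Zproc 0 w = 1"
| "Zproc (Suc n) w = (\<Sum>i<Zproc n w. w (Suc n, i))"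

definition Wproc :: "(nat \<Rightarrow> 'e \<Rightarrow> real) \<Rightarrow> 'e \<Rightarrow> nat \<Rightarrow> (nat \<times> nat \<Rightarrow> nat) \<Rightarrow> real" where
  "Wproc A x n w = Pi_env A x n * real (Zproc n w)"

definition nat_filtration :: "'a measure \<Rightarrow> (nat \<Rightarrow> 'a \<Rightarrow> real) \<Rightarrow> nat \<Rightarrow> 'a measure" where
  "nat_filtration M X n =
     sigma (space M) {X k -` S \<inter> space M | k S. k \<le> n \<and> S \<in> sets borel}"

definition martingale :: "'a measure \<Rightarrow> (nat \<Rightarrow> 'a measure) \<Rightarrow> (nat \<Rightarrow> 'a \<Rightarrow> real) \<Rightarrow> bool" where
  "martingale M F X \<longleftrightarrow>
     (\<forall>n. subalgebra M (F n)) \<and>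
     (\<forall>n m. n \<le> m \<longrightarrow> sets (F n) \<subseteq> sets (F m)) \<and>
     (\<forall>n. X n \<in> borel_measurable (F n)) \<and>
     (\<forall>n. integrable M (X n)) \<and>
     (\<forall>n. AE w in M. real_cond_exp M (F n) (X (Suc n)) w = X n w)"

end

theory Submission
  imports Defs
begin

text \<open>Fix an environment. Composing linear fractional generating functions shows that, under the
  quenched law, \<open>Z n\<close> is again linear fractional with parameters \<open>\<Pi> n\<close> and
  \<open>R n = (\<Sum>k<n. \<Pi> k * B (Suc k))\<close>; this gives an explicit geometric tail for \<open>W n = \<Pi> n * Z n\<close>.
  The two conditions of supercriticality together force \<open>\<Pi> n \<longlonglongrightarrow> 0\<close>, pathwise in the
  environment, and then the tail of \<open>W n\<close> at \<open>t \<ge> 0\<close> converges to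
  \<open>exp (- t / R) / R\<close>. Almost sure convergence of the nonnegative martingale \<open>W\<close> is Doob's upcrossing
  argument, and it identifies the law of the limit with the limit of the laws.\<close>

section \<open>Almost sure convergence of nonnegative martingales\<close>

context prob_space begin

text \<open>In the coordinate \<open>1 / (1 - s)\<close> the generating function of
  \<open>LF a b\<close> is the affine map sending \<open>u\<close> to \<open>a * u + b\<close>.
  Composing such maps multiplies the slopes, which gives \<open>\<Pi> n\<close>, and accumulates the
  intercepts, which gives \<open>R n\<close>. The probability that \<open>Z n\<close> is positive is
  then \<open>1 / (\<Pi> n + R n)\<close>, whose limit \<open>1 / R\<close> is the weight of the
  exponential part. Almost sure convergence by itself only shows that the limit has mean at most
  one; that the mean equals one is read off the explicit limit law, in place of a uniform
  integrability argument.\<close>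

lemma martingale_integral_step:
  assumes "martingale M F X" "D \<in> sets (F n)"
  shows "(\<integral>w. indicator D w * X (Suc n) w \<partial>M) = (\<integral>w. indicator D w * X n w \<partial>M)"
proof -
  have sub: "subalgebra M (F n)" and int: "integrable M (X (Suc n))"
    and ce: "AE w in M. real_cond_exp M (F n) (X (Suc n)) w = X n w"
    and ad: "X n \<in> borel_measurable (F n)"
    using assms(1) unfolding martingale_def by blast+
  interpret finite_measure_subalgebra M "F n"
    by unfold_locales (rule sub)
  have D: "D \<in> sets M" using sub assms(2) unfolding subalgebra_def by blast
  have X [measurable]: "X n \<in> borel_measurable M"
    using measurable_from_subalg[OF sub ad] .
  have [measurable]: "real_cond_exp M (F n) (X (Suc n)) \<in> borel_measurable M"
    using borel_measurable_cond_exp2 by simp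
  have "(\<integral>w. indicator D w * X (Suc n) w \<partial>M)
      = (\<integral>w. indicator D w * real_cond_exp M (F n) (X (Suc n)) w \<partial>M)"
    using real_cond_exp_intA[OF int assms(2)] unfolding set_lebesgue_integral_def by simp
  also have "\<dots> = (\<integral>w. indicator D w * X n w \<partial>M)"
    using ce D by (intro integral_cong_AE) auto
  finally show ?thesis .
qed

end

text \<open>A gambler holds one unit of the game from the first time \<open>X < a\<close> until the next time
  \<open>X > b\<close>, and so on; \<open>upcrossings\<close> counts the completed rounds.\<close>

primrec holding :: "real \<Rightarrow> real \<Rightarrow> (nat \<Rightarrow> real) \<Rightarrow> nat \<Rightarrow> bool" where
  "holding a b x 0 \<longleftrightarrow> x 0 < a"
| "holding a b x (Suc n) \<longleftrightarrow> (if holding a b x n then x (Suc n) \<le> b else x (Suc n) < a)"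

primrec upcrossings :: "real \<Rightarrow> real \<Rightarrow> (nat \<Rightarrow> real) \<Rightarrow> nat \<Rightarrow> nat" where
  "upcrossings a b x 0 = 0"
| "upcrossings a b x (Suc n) =
     upcrossings a b x n + (if holding a b x n \<and> b < x (Suc n) then 1 else 0)"

text \<open>Each completed round buys below \<open>a\<close> and sells above \<open>b\<close>. The
  last summand on the left values a unit still held as if it had been bought at \<open>a\<close>,
  which underestimates its gain; with this term the induction closes.\<close>

lemma gain_ge_upcrossings:
  assumes "a < b"
  shows "(b - a) * upcrossings a b x n + (if holding a b x n then x n - a else 0)
     \<le> (\<Sum>k<n. of_bool (holding a b x k) * (x (Suc k) - x k))"
  using assms by (induction n) (auto simp: algebra_simps)

lemma upcrossings_mono: "n \<le> m \<Longrightarrow> upcrossings a b x n \<le> upcrossings a b x m"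
  by (rule lift_Suc_mono_le[of "upcrossings a b x"]) auto

lemma upcrossings_unbounded:
  assumes "a < b" and low: "\<exists>\<^sub>F n in sequentially. x n < a" and high: "\<exists>\<^sub>F n in sequentially. b < x n"
  shows "\<exists>n. K \<le> upcrossings a b x n"
proof (induction K)
  case (Suc K)
  then obtain N where N: "K \<le> upcrossings a b x N" by blast
  obtain n where n: "n \<ge> Suc N" "x n < a" using low by (auto simp: frequently_sequentially)
  obtain m where m: "m \<ge> n" "b < x m" using high by (auto simp: frequently_sequentially)
  show ?case
  proof (rule ccontr)
    assume "\<not> ?thesis"
    then have const: "upcrossings a b x k \<le> K" for k by (meson not_less_eq_eq)
    \<comment> \<open>At \<open>n\<close> the gambler holds because \<open>x n < a\<close>. A later
      sale would complete round \<open>Suc K\<close>, so the unit is held for ever and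
      \<open>x\<close> never exceeds \<open>b\<close> again.\<close>
    have "holding a b x k \<and> x k \<le> b" if "n \<le> k" for k
      using that
    proof (induction k rule: dec_induct)
      case base
      obtain n' where "n = Suc n'" using n(1) by (cases n) auto
      then show ?case using n(2) assms(1) by auto
    next
      case (step k)
      have "K \<le> upcrossings a b x k"
        using upcrossings_mono[of N k a b x] N n(1) step(1) by linarith
      with const[of "Suc k"] step show ?case by (auto split: if_splits)
    qed
    from this[of m] m show False by simp
  qed
qed simp

text \<open>Doob's upcrossing inequality: the expected gain of the gambler is 0, while nonnegativity
  of \<open>X\<close> limits the loss on an open position to \<open>max 0 a\<close>. The bound on
  the expected count is uniform in \<open>n\<close>, so monotone convergence makes the total count
  almost surely finite.\<close>

lemma (in prob_space) nonneg_martingale_upcrossings_finite: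
  assumes mart: "martingale M F X" and nonneg: "\<And>n w. 0 \<le> X n w" and "a < b"
  shows "AE w in M. \<exists>K. \<forall>n. upcrossings a b (\<lambda>n. X n w) n \<le> K"
proof -
  have sub: "\<And>n. subalgebra M (F n)" and mono: "\<And>n m. n \<le> m \<Longrightarrow> sets (F n) \<subseteq> sets (F m)"
    and ad: "\<And>n. X n \<in> borel_measurable (F n)" and int: "\<And>n. integrable M (X n)"
    using mart unfolding martingale_def by blast+
  have spF: "space (F n) = space M" for n using sub[of n] unfolding subalgebra_def by simp
  have adm: "X k \<in> borel_measurable (F n)" if "k \<le> n" for k n
    using ad[of k] mono[OF that] by (auto simp: measurable_def spF)
  have [measurable]: "X n \<in> borel_measurable M" for n using int by auto
  let ?H = "\<lambda>n w. holding a b (\<lambda>n. X n w) n"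
  let ?U = "\<lambda>n w. upcrossings a b (\<lambda>n. X n w) n"
  have H: "Measurable.pred (F m) (?H n)" if "n \<le> m" for n m
    using that
  proof (induction n arbitrary: m)
    case 0
    have [measurable]: "X 0 \<in> borel_measurable (F m)" using 0 by (intro adm) auto
    show ?case unfolding holding.simps by measurable
  next
    case (Suc n)
    have [measurable]: "X (Suc n) \<in> borel_measurable (F m)" using Suc by (intro adm) auto
    have [measurable]: "Measurable.pred (F m) (?H n)" using Suc by auto
    show ?case unfolding holding.simps by measurable
  qed
  have HM [measurable]: "Measurable.pred M (?H n)" for n
    using measurable_from_subalg[OF sub H[OF order_refl]] by simp
  have UM [measurable]: "?U n \<in> measurable M (count_space UNIV)" for n
    by (induction n) auto
  have bound: "(\<integral>\<^sup>+w. ennreal (real (?U n w)) \<partial>M) \<le> ennreal (max 0 a / (b - a))" for n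
  proof -
    let ?G = "\<lambda>w. \<Sum>k<n. of_bool (?H k w) * (X (Suc k) w - X k w)"
    have intH: "integrable M (\<lambda>w. of_bool (?H k w) * X m w)" for k m
      by (rule Bochner_Integration.integrable_bound[OF int[of m]]) auto
    \<comment> \<open>Whether a unit is held at time \<open>k\<close> is decided by
      \<open>F k\<close>, so the increment that follows has mean zero on that event.\<close>
    have "(\<integral>w. of_bool (?H k w) * (X (Suc k) w - X k w) \<partial>M) = 0" for k
    proof -
      let ?D = "{w \<in> space (F k). ?H k w}"
      have "?D \<in> sets (F k)" using H[of k k] by measurable
      then have "(\<integral>w. indicator ?D w * X (Suc k) w \<partial>M) = (\<integral>w. indicator ?D w * X k w \<partial>M)"
        by (rule martingale_integral_step[OF mart])
      moreover have "(\<integral>w. indicator ?D w * X m w \<partial>M) = (\<integral>w. of_bool (?H k w) * X m w \<partial>M)" for m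
        by (intro Bochner_Integration.integral_cong) (auto simp: spF)
      ultimately show ?thesis using intH by (simp add: right_diff_distrib)
    qed
    then have G0: "(\<integral>w. ?G w \<partial>M) = 0" and Gint: "integrable M ?G"
      using intH by (simp_all add: right_diff_distrib)
    have le: "real (?U n w) \<le> (?G w + max 0 a) / (b - a)" for w
    proof -
      have "(b - a) * ?U n w \<le> ?G w + max 0 a"
        using gain_ge_upcrossings[OF \<open>a < b\<close>, of "\<lambda>n. X n w" n] nonneg[of n w]
        by (simp split: if_splits)
      then show ?thesis using \<open>a < b\<close> by (simp add: field_simps)
    qed
    have "(\<integral>\<^sup>+w. ennreal (real (?U n w)) \<partial>M) \<le> (\<integral>\<^sup>+w. ennreal ((?G w + max 0 a) / (b - a)) \<partial>M)"
      using le by (intro nn_integral_mono ennreal_leI)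
    also have "\<dots> = ennreal (\<integral>w. (?G w + max 0 a) / (b - a) \<partial>M)"
    proof (rule nn_integral_eq_integral)
      show "integrable M (\<lambda>w. (?G w + max 0 a) / (b - a))" using Gint by simp
      show "AE w in M. 0 \<le> (?G w + max 0 a) / (b - a)"
        using le by (intro AE_I2) (meson of_nat_0_le_iff order_trans)
    qed
    also have "(\<integral>w. (?G w + max 0 a) / (b - a) \<partial>M) = max 0 a / (b - a)"
      using Gint G0 by (simp add: prob_space)
    finally show ?thesis .
  qed
  have "(\<integral>\<^sup>+w. (SUP n. ennreal (real (?U n w))) \<partial>M) = (SUP n. \<integral>\<^sup>+w. ennreal (real (?U n w)) \<partial>M)"
    by (intro nn_integral_monotone_convergence_SUP)
       (auto simp: incseq_def le_fun_def intro!: upcrossings_mono)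
  also have "\<dots> \<le> ennreal (max 0 a / (b - a))" using bound by (intro SUP_least)
  finally have "(\<integral>\<^sup>+w. (SUP n. ennreal (real (?U n w))) \<partial>M) \<noteq> \<infinity>" by (auto simp: top_unique)
  then have "AE w in M. (SUP n. ennreal (real (?U n w))) \<noteq> \<infinity>"
    by (intro nn_integral_PInf_AE) auto
  then show ?thesis
  proof eventually_elim
    case (elim w)
    then obtain c where c: "(SUP n. ennreal (real (?U n w))) = ennreal c" "0 \<le> c"
      by (metis ennreal_cases infinity_ennreal_def)
    have "?U n w \<le> nat \<lceil>c\<rceil>" for n
    proof -
      have "ennreal (real (?U n w)) \<le> ennreal c"
        unfolding c(1)[symmetric] by (rule SUP_upper) simp
      then have "real (?U n w) \<le> c" using c(2) by (simp add: ennreal_le_iff)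
      then show ?thesis by linarith
    qed
    then show ?case by blast
  qed
qed

text \<open>Two failures must be excluded. Oscillation would cross some pair of rational levels
  infinitely often, and there are only countably many such pairs; escape to infinity contradicts
  Fatou's lemma, since all \<open>X n\<close> have the same mean.\<close>

lemma (in prob_space) nonneg_martingale_converges:
  assumes mart: "martingale M F X" and nonneg: "\<And>n w. 0 \<le> X n w"
  shows "AE w in M. convergent (\<lambda>n. X n w)"
proof -
  have int: "\<And>n. integrable M (X n)"
    and F0: "\<And>n. space M \<in> sets (F n)"
    using mart unfolding martingale_def subalgebra_def by (blast, metis sets.top)
  have [measurable]: "X n \<in> borel_measurable M" for n using int by auto
  have "(\<integral>w. X n w \<partial>M) = (\<integral>w. X 0 w \<partial>M)" for n
  proof (induction n)
    case (Suc n)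
    have "(\<integral>w. X m w \<partial>M) = (\<integral>w. indicator (space M) w * X m w \<partial>M)" for m
      by (intro Bochner_Integration.integral_cong) auto
    then show ?case using Suc martingale_integral_step[OF mart F0[of n]] by simp
  qed simp
  then have E: "(\<integral>\<^sup>+w. ennreal (X n w) \<partial>M) = ennreal (\<integral>w. X 0 w \<partial>M)" for n
    using int[of n] nonneg by (subst nn_integral_eq_integral) auto
  have "(\<integral>\<^sup>+w. liminf (\<lambda>n. ennreal (X n w)) \<partial>M) \<le> liminf (\<lambda>n. \<integral>\<^sup>+w. ennreal (X n w) \<partial>M)"
    by (intro nn_integral_liminf) auto
  also have "\<dots> = ennreal (\<integral>w. X 0 w \<partial>M)" unfolding E by (simp add: Liminf_const)
  finally have "(\<integral>\<^sup>+w. liminf (\<lambda>n. ennreal (X n w)) \<partial>M) \<noteq> \<infinity>" by (auto simp: top_unique)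
  then have fin: "AE w in M. liminf (\<lambda>n. ennreal (X n w)) \<noteq> \<infinity>"
    by (intro nn_integral_PInf_AE) auto
  have "AE w in M. \<forall>p\<in>{(a, b). a < b}.
      \<exists>K. \<forall>n. upcrossings (of_rat (fst p)) (of_rat (snd p)) (\<lambda>n. X n w) n \<le> K"
    using nonneg_martingale_upcrossings_finite[OF mart nonneg]
    by (subst AE_ball_countable) (auto simp: of_rat_less)
  with fin show ?thesis
  proof eventually_elim
    case (elim w)
    let ?Y = "\<lambda>n. ennreal (X n w)"
    have "limsup ?Y \<le> liminf ?Y"
    proof (rule ccontr)
      assume "\<not> limsup ?Y \<le> liminf ?Y"
      \<comment> \<open>Both \<open>c\<close> and \<open>d\<close> lie below the upper limit and are
        therefore finite; the rational levels \<open>p < q\<close> are then placed between their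
        real values.\<close>
      then obtain c where c: "liminf ?Y < c" "c < limsup ?Y" by (meson dense not_le)
      then obtain d where d: "liminf ?Y < d" "d < c" by (meson dense)
      obtain c' d' where cd: "c = ennreal c'" "d = ennreal d'" "0 \<le> c'" "0 \<le> d'"
        using c d by (metis ennreal_cases less_top not_less_iff_gr_or_eq order.strict_trans)
      have "d' < c'" using d(2) cd by (simp add: ennreal_less_iff)
      then obtain q where q: "d' < of_rat q" "of_rat q < c'" using of_rat_dense by blast
      obtain p where p: "d' < of_rat p" "of_rat p < (of_rat q :: real)"
        using of_rat_dense[OF q(1)] by blast
      have "\<exists>\<^sub>F n in sequentially. ?Y n < d"
        using d(1) Liminf_bounded[of d ?Y sequentially] by (fastforce simp: frequently_def not_less)
      then have low: "\<exists>\<^sub>F n in sequentially. X n w < of_rat p"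
        by (rule frequently_elim1) (use cd p nonneg in \<open>simp add: ennreal_less_iff\<close>)
      have "\<exists>\<^sub>F n in sequentially. c < ?Y n"
        using c(2) Limsup_bounded[of ?Y c sequentially] by (fastforce simp: frequently_def not_less)
      then have high: "\<exists>\<^sub>F n in sequentially. of_rat q < X n w"
        by (rule frequently_elim1) (use cd q nonneg in \<open>simp add: ennreal_less_iff\<close>)
      obtain K where K: "\<forall>n. upcrossings (of_rat p) (of_rat q) (\<lambda>n. X n w) n \<le> K"
        using elim(2) p(2) by (force simp: of_rat_less)
      obtain n where "Suc K \<le> upcrossings (of_rat p) (of_rat q) (\<lambda>n. X n w) n"
        using upcrossings_unbounded[OF p(2) low high] by blast
      with K show False by (metis not_less_eq_eq)
    qed
    moreover obtain l where l: "liminf ?Y = ennreal l" "0 \<le> l"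
      using elim(1) by (metis ennreal_cases infinity_ennreal_def)
    moreover have "liminf ?Y \<le> limsup ?Y" by (rule Liminf_le_Limsup) simp
    ultimately have "?Y \<longlonglongrightarrow> ennreal l" by (intro tendsto_iff_Liminf_eq_Limsup[THEN iffD2]) auto
    then have "(\<lambda>n. X n w) \<longlonglongrightarrow> l"
      using l(2) nonneg by (subst (asm) tendsto_ennreal_iff) auto
    then show ?case by (auto simp: convergent_def)
  qed
qed

text \<open>Half of the portmanteau argument: the indicator of an open set is lower semicontinuous,
  so Fatou's lemma applies. The bound \<open>u\<close> may exceed the probability itself, so that an
  open half-line can be compared with the closed one whose probability is known.\<close>

lemma (in prob_space) measure_open_le_limit:
  fixes X :: "'a \<Rightarrow> real"
  assumes [measurable]: "\<And>n. Xn n \<in> borel_measurable M" "X \<in> borel_measurable M"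
    and lim: "AE w in M. (\<lambda>n. Xn n w) \<longlonglongrightarrow> X w"
    and U: "open U" and le: "\<And>n. measure M {w \<in> space M. Xn n w \<in> U} \<le> u n" and u: "u \<longlonglongrightarrow> c"
  shows "measure M {w \<in> space M. X w \<in> U} \<le> c"
proof -
  have [measurable]: "U \<in> sets borel" using U by simp
  have c: "0 \<le> c"
    by (rule LIMSEQ_le_const[OF u]) (use le measure_nonneg order_trans in blast)
  have ind: "(\<integral>\<^sup>+w. indicator U (Y w) \<partial>M) = emeasure M {w \<in> space M. Y w \<in> U}"
    if [measurable]: "Y \<in> borel_measurable M" for Y :: "'a \<Rightarrow> real"
  proof -
    have "(\<integral>\<^sup>+w. indicator U (Y w) \<partial>M) = (\<integral>\<^sup>+w. indicator {w \<in> space M. Y w \<in> U} w \<partial>M)"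
      by (intro nn_integral_cong) (simp add: indicator_def)
    then show ?thesis by simp
  qed
  have "emeasure M {w \<in> space M. X w \<in> U} = (\<integral>\<^sup>+w. indicator U (X w) \<partial>M)"
    by (simp add: ind)
  also have "\<dots> \<le> (\<integral>\<^sup>+w. liminf (\<lambda>n. indicator U (Xn n w)) \<partial>M)"
  proof (rule nn_integral_mono_AE)
    show "AE w in M. indicator U (X w) \<le> (liminf (\<lambda>n. indicator U (Xn n w)) :: ennreal)"
      using lim
    proof eventually_elim
      case (elim w)
      show ?case
      proof (cases "X w \<in> U")
        case True
        then have "\<forall>\<^sub>F n in sequentially. Xn n w \<in> U"
          using topological_tendstoD[OF elim U] by simp
        then have "\<forall>\<^sub>F n in sequentially. (1 :: ennreal) \<le> indicator U (Xn n w)"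
          by eventually_elim simp
        then show ?thesis using True by (auto intro: Liminf_bounded)
      qed simp
    qed
  qed
  also have "\<dots> \<le> liminf (\<lambda>n. \<integral>\<^sup>+w. indicator U (Xn n w) \<partial>M)"
    by (rule nn_integral_liminf) measurable
  also have "\<dots> = liminf (\<lambda>n. emeasure M {w \<in> space M. Xn n w \<in> U})"
    by (simp add: ind)
  also have "\<dots> \<le> liminf (\<lambda>n. ennreal (u n))"
    using le by (intro Liminf_mono) (auto simp: emeasure_eq_measure intro!: ennreal_leI always_eventually)
  also have "\<dots> = ennreal c"
    using u by (intro lim_imp_Liminf) auto
  finally show ?thesis using c by (simp add: emeasure_eq_measure)
qed

section \<open>Linear fractional laws\<close>

text \<open>The expansions are known only for \<open>s\<close> in \<open>[0, 1)\<close>. By strong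
  induction the lower coefficients of the difference vanish; dividing by \<open>s ^ n\<close> leaves
  a series whose constant term is its limit at 0 from the right.\<close>

lemma powser_coeff_unique:
  fixes c d :: "nat \<Rightarrow> real"
  assumes sums: "\<And>s. 0 \<le> s \<Longrightarrow> s < 1 \<Longrightarrow> (\<lambda>k. c k * s ^ k) sums f s"
    "\<And>s. 0 \<le> s \<Longrightarrow> s < 1 \<Longrightarrow> (\<lambda>k. d k * s ^ k) sums f s"
  shows "c = d"
proof
  define e where "e k = c k - d k" for k
  have e: "(\<lambda>k. e k * s ^ k) sums 0" if "0 \<le> s" "s < 1" for s
    using sums_diff[OF sums(1)[OF that] sums(2)[OF that]] by (simp add: e_def left_diff_distrib)
  fix n
  have "e n = 0"
  proof (induction n rule: less_induct)
    case (less n)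
    have shift: "(\<lambda>k. e (k + n) * s ^ k) sums 0" if "0 < s" "s < 1" for s
    proof -
      have "(\<lambda>k. e (k + n) * s ^ (k + n)) sums 0"
        using e[of s] that less sums_iff_shift[of "\<lambda>k. e k * s ^ k" n 0] by simp
      from sums_mult[OF this, of "1 / s ^ n"] show ?thesis
        using that by (simp add: power_add)
    qed
    define g where "g x = (\<Sum>k. e (k + n) * x ^ k)" for x
    \<comment> \<open>Convergence at the single point \<open>1/2\<close> gives convergence for all
      \<open>x\<close> of smaller modulus, negative ones included.\<close>
    have "(\<lambda>k. e (k + n) * x ^ k) sums g x" if "norm x < 1/2" for x
    proof -
      have "summable (\<lambda>k. e (k + n) * (1/2) ^ k)" using shift[of "1/2"] by (auto simp: sums_iff)
      then have "summable (\<lambda>k. e (k + n) * x ^ k)"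
        by (rule powser_inside) (use that in auto)
      then show ?thesis by (simp add: g_def summable_sums)
    qed
    then have "(g \<longlongrightarrow> e (0 + n)) (at 0)" by (intro powser_limit_0[of "1/2"]) auto
    then have "(g \<longlongrightarrow> e n) (at_right 0)" by (simp add: filterlim_at_split)
    moreover have "(g \<longlongrightarrow> 0) (at_right 0)"
      by (rule tendsto_eventually, rule eventually_at_rightI[of 0 1])
         (use shift in \<open>auto simp: g_def sums_iff\<close>)
    ultimately show ?case by (meson tendsto_unique trivial_limit_at_right_real)
  qed
  then show "c n = d n" by (simp add: e_def)
qed

text \<open>Solving \<open>1 / (1 - f) = a / (1 - s) + b\<close> for \<open>f\<close> and expanding
  in \<open>s\<close> gives an atom at 0 and, on the positive integers, a geometric law with ratio
  \<open>b / (a + b)\<close> and total mass \<open>1 / (a + b)\<close>. The case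
  \<open>b = 0\<close> occurs for \<open>Z 0\<close>; there \<open>0 ^ 0 = 1\<close> puts all
  positive mass at 1.\<close>

definition lf_coeff :: "real \<Rightarrow> real \<Rightarrow> nat \<Rightarrow> real" where
  "lf_coeff a b k = (if k = 0 then 1 - 1 / (a + b)
     else a / (a + b)\<^sup>2 * (b / (a + b)) ^ (k - 1))"

context
  fixes a b :: real
  assumes a: "0 < a" and b: "0 \<le> b" and ab: "1 \<le> a + b"
begin

lemma lf_coeff_nonneg: "0 \<le> lf_coeff a b k"
  using a b ab by (auto simp: lf_coeff_def divide_le_eq)

lemma lf_coeff_sums:
  assumes s: "0 \<le> s" "s \<le> 1"
  shows "(\<lambda>k. lf_coeff a b k * s ^ k) sums (1 - (1 - s) / (a + b * (1 - s)))"
proof -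
  have pos: "0 < a + b * (1 - s)" using a b s by (simp add: add_pos_nonneg)
  have "b * s \<le> b * 1" using b s by (intro mult_left_mono) auto
  then have lt: "b * s < a + b" using a by linarith
  have "(\<lambda>k. (b * s / (a + b)) ^ k) sums (1 / (1 - b * s / (a + b)))"
    using lt ab b s by (intro geometric_sums) (simp add: abs_of_nonneg)
  then have "(\<lambda>k. a / (a + b)\<^sup>2 * s * (b * s / (a + b)) ^ k) sums
      (a / (a + b)\<^sup>2 * s * (1 / (1 - b * s / (a + b))))"
    by (rule sums_mult)
  then have "(\<lambda>k. lf_coeff a b (Suc k) * s ^ Suc k) sums
      (a / (a + b)\<^sup>2 * s * (1 / (1 - b * s / (a + b))))"
    by (simp add: lf_coeff_def power_divide power_mult_distrib mult_ac)
  then have "(\<lambda>k. lf_coeff a b k * s ^ k) sums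
      (a / (a + b)\<^sup>2 * s * (1 / (1 - b * s / (a + b))) + (1 - 1 / (a + b)))"
    by (subst (asm) sums_Suc_iff) (simp add: lf_coeff_def)
  also have "a / (a + b)\<^sup>2 * s * (1 / (1 - b * s / (a + b))) + (1 - 1 / (a + b))
      = 1 - (1 - s) / (a + b * (1 - s))"
  proof -
    have "1 - b * s / (a + b) = (a + b * (1 - s)) / (a + b)" using ab by (simp add: field_simps)
    then have "a / (a + b)\<^sup>2 * s * (1 / (1 - b * s / (a + b))) + (1 - 1 / (a + b))
      = a * s / ((a + b) * (a + b * (1 - s))) + (1 - 1 / (a + b))"
      using ab by (simp add: power2_eq_square)
    also have "\<dots> = 1 - (1 - s) / (a + b * (1 - s))"
      using ab pos by (simp add: divide_simps) (simp add: algebra_simps)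
    finally show ?thesis .
  qed
  finally show ?thesis .
qed

text \<open>\<open>LF\<close> is a definite description, so existence and uniqueness are both at
  stake: \<open>lf_coeff\<close> is nonnegative and sums to 1, and the defining relation fixes the
  generating function on \<open>[0, 1)\<close>, hence its coefficients.\<close>

lemma pmf_LF: "pmf (LF a b) k = lf_coeff a b k"
proof -
  have one: "lf_coeff a b sums 1" using lf_coeff_sums[of 1] by simp
  have "(\<integral>\<^sup>+k. ennreal (lf_coeff a b k) \<partial>count_space UNIV) = 1"
    using one lf_coeff_nonneg
    by (simp add: nn_integral_count_space_nat sums_iff suminf_ennreal2)
  then have pmf: "pmf (embed_pmf (lf_coeff a b)) = lf_coeff a b"
    using lf_coeff_nonneg by (intro ext pmf_embed_pmf) auto
  have "LF a b = embed_pmf (lf_coeff a b)"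
    unfolding LF_def
  proof (rule the_equality, safe)
    fix s :: real assume "s \<in> {0..<1}"
    then have "(\<Sum>k. lf_coeff a b k * s ^ k) = 1 - (1 - s) / (a + b * (1 - s))"
      using lf_coeff_sums[of s] by (simp add: sums_iff)
    then have "1 / (1 - (\<Sum>k. lf_coeff a b k * s ^ k)) = (a + b * (1 - s)) / (1 - s)"
      by simp
    also have "\<dots> = a / (1 - s) + b" using \<open>s \<in> {0..<1}\<close> by (simp add: add_divide_distrib)
    finally show "1 / (1 - (\<Sum>k. pmf (embed_pmf (lf_coeff a b)) k * s ^ k)) = a / (1 - s) + b"
      unfolding pmf .
  next
    fix p :: "nat pmf"
    assume p: "\<forall>s\<in>{0..<1}. 1 / (1 - (\<Sum>k. pmf p k * s ^ k)) = a / (1 - s) + b"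
    have "pmf p = lf_coeff a b"
    proof (rule powser_coeff_unique)
      fix s :: real assume s: "0 \<le> s" "s < 1"
      then show "(\<lambda>k. lf_coeff a b k * s ^ k) sums (1 - (1 - s) / (a + b * (1 - s)))"
        by (intro lf_coeff_sums) auto
      have "summable (\<lambda>k. pmf p k * s ^ k)"
      proof (rule summable_comparison_test')
        show "summable (\<lambda>k. s ^ k)" using s by (intro summable_geometric) auto
        show "norm (pmf p k * s ^ k) \<le> s ^ k" if "k \<ge> 0" for k
          using s by (simp add: abs_mult pmf_le_1 mult_left_le_one_le)
      qed
      moreover have "1 / (1 - (\<Sum>k. pmf p k * s ^ k)) = a / (1 - s) + b" using p s by auto
      then have "1 - (\<Sum>k. pmf p k * s ^ k) = 1 / (a / (1 - s) + b)"
        by (metis div_by_1 divide_divide_eq_right mult_1)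
      then have "(\<Sum>k. pmf p k * s ^ k) = 1 - 1 / (a / (1 - s) + b)" by linarith
      then have "(\<Sum>k. pmf p k * s ^ k) = 1 - (1 - s) / (a + b * (1 - s))"
        using s by (simp add: divide_simps)
      ultimately show "(\<lambda>k. pmf p k * s ^ k) sums (1 - (1 - s) / (a + b * (1 - s)))"
        by (simp add: sums_iff)
    qed
    then show "p = embed_pmf (lf_coeff a b)" by (intro pmf_eqI) (simp add: pmf)
  qed
  then show ?thesis by (simp add: pmf)
qed

text \<open>The factor \<open>1 / a\<close> is what the next factor of \<open>Pi_env\<close>
  cancels; this is the source of the martingale property.\<close>

lemma nn_integral_LF_mean: "(\<integral>\<^sup>+k. ennreal (real k) \<partial>measure_pmf (LF a b)) = ennreal (1 / a)"
proof -
  define q where "q = b / (a + b)"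
  have q: "0 \<le> q" "q < 1" "1 - q = a / (a + b)" using a b ab by (auto simp: q_def field_simps)
  have "(\<lambda>k. q ^ k * real k) sums (q / (1 - q)\<^sup>2)" "(\<lambda>k. q ^ k) sums (1 / (1 - q))"
    using q geometric_sums_times_n[of q] geometric_sums[of q] by auto
  note sums_mult[OF sums_add[OF this], of "a / (a + b)\<^sup>2"]
  moreover have "lf_coeff a b (Suc k) * real (Suc k) = a / (a + b)\<^sup>2 * (q ^ k * real k + q ^ k)" for k
  proof -
    have "lf_coeff a b (Suc k) = a / (a + b)\<^sup>2 * q ^ k" by (simp add: lf_coeff_def q_def)
    then show ?thesis by (simp only: of_nat_Suc ring_distribs mult_1_right mult_1_left mult_ac add.commute)
  qed
  ultimately have "(\<lambda>k. lf_coeff a b (Suc k) * real (Suc k)) sums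
      (a / (a + b)\<^sup>2 * (q / (1 - q)\<^sup>2 + 1 / (1 - q)))"
    by (simp only:)
  also have "q / (1 - q)\<^sup>2 + 1 / (1 - q) = 1 / (1 - q)\<^sup>2"
  proof -
    have "1 / (1 - q) = (1 - q) / (1 - q)\<^sup>2" using q by (simp add: power2_eq_square)
    then show ?thesis by (simp flip: add_divide_distrib)
  qed
  also have "a / (a + b)\<^sup>2 * (1 / (1 - q)\<^sup>2) = 1 / a"
    unfolding q(3) using a ab by (simp add: power_divide power2_eq_square)
  finally have sums: "(\<lambda>k. lf_coeff a b k * real k) sums (1 / a)"
    by (subst (asm) sums_Suc_iff) simp
  have "(\<integral>\<^sup>+k. ennreal (real k) \<partial>measure_pmf (LF a b)) = (\<Sum>k. ennreal (lf_coeff a b k * real k))"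
    by (simp add: nn_integral_measure_pmf nn_integral_count_space_nat pmf_LF ennreal_mult lf_coeff_nonneg)
  also have "\<dots> = ennreal (1 / a)"
    using sums lf_coeff_nonneg by (subst suminf_ennreal2) (auto simp: sums_iff)
  finally show ?thesis .
qed

lemma nn_integral_LF_pgf:
  assumes s: "0 \<le> s" "s \<le> 1"
  shows "(\<integral>\<^sup>+k. ennreal (s ^ k) \<partial>measure_pmf (LF a b)) = ennreal (1 - (1 - s) / (a + b * (1 - s)))"
proof -
  have "(\<integral>\<^sup>+k. ennreal (s ^ k) \<partial>measure_pmf (LF a b)) = (\<Sum>k. ennreal (lf_coeff a b k * s ^ k))"
    using s by (simp add: nn_integral_measure_pmf nn_integral_count_space_nat pmf_LF ennreal_mult lf_coeff_nonneg)
  also have "\<dots> = ennreal (1 - (1 - s) / (a + b * (1 - s)))"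
    using lf_coeff_sums[OF s] lf_coeff_nonneg s by (subst suminf_ennreal2) (auto simp: sums_iff)
  finally show ?thesis .
qed

text \<open>The mass beyond \<open>j\<close> starts from \<open>1 / (a + b)\<close> and keeps the
  share \<open>b / (a + b)\<close> at each further value. Powers of this share become the
  exponential in the limit.\<close>

lemma sum_lf_coeff: "(\<Sum>k\<le>j. lf_coeff a b k) = 1 - 1 / (a + b) * (b / (a + b)) ^ j"
proof (induction j)
  case 0
  show ?case by (simp add: lf_coeff_def)
next
  case (Suc j)
  have "1 / (a + b) - a / (a + b)\<^sup>2 = 1 / (a + b) * (b / (a + b))"
  proof -
    have "1 / (a + b) = (a + b) / (a + b)\<^sup>2" using ab by (simp add: power2_eq_square)
    also have "\<dots> - a / (a + b)\<^sup>2 = b / (a + b)\<^sup>2" by (simp flip: diff_divide_distrib)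
    finally show ?thesis by (simp add: power2_eq_square)
  qed
  then have "(1 / (a + b) - a / (a + b)\<^sup>2) * (b / (a + b)) ^ j
      = 1 / (a + b) * (b / (a + b)) ^ Suc j" by simp
  moreover have "lf_coeff a b (Suc j) = a / (a + b)\<^sup>2 * (b / (a + b)) ^ j"
    by (simp add: lf_coeff_def)
  ultimately show ?case by (simp add: Suc left_diff_distrib)
qed

end

section \<open>Branching in a varying environment\<close>

abbreviation offspring_measure :: "(nat \<Rightarrow> nat pmf) \<Rightarrow> nat \<times> nat \<Rightarrow> nat measure" where
  "offspring_measure p \<equiv> \<lambda>(k, i). measure_pmf (p k)"

lemma sets_offspring_measure [simp]: "sets (offspring_measure p x) = UNIV"
  and space_offspring_measure [simp]: "space (offspring_measure p x) = UNIV"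
  by (auto simp: case_prod_beta)

lemma prob_space_offspring_measure: "prob_space (offspring_measure p x)"
  by (auto simp: case_prod_beta prob_space_measure_pmf)

lemma measurable_offspring [measurable]:
  assumes "x \<in> I"
  shows "(\<lambda>w. w x) \<in> measurable (PiM I (offspring_measure p)) (count_space UNIV)"
proof -
  have "(\<lambda>w. w x) \<in> measurable (PiM I (offspring_measure p)) (offspring_measure p x)"
    by (rule measurable_component_singleton[OF assms])
  also have "measurable (PiM I (offspring_measure p)) (offspring_measure p x)
      = measurable (PiM I (offspring_measure p)) (count_space UNIV)"
    by (rule measurable_cong_sets) auto
  finally show ?thesis .
qed

text \<open>The index set is left free so that \<open>Zproc n\<close> is measurable both on the full
  product and with respect to the first \<open>n\<close> generations alone. The number of summands
  is random but countably valued, so it can be frozen at each \<open>j\<close>.\<close>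

lemma measurable_Zproc:
  assumes "{1..n} \<times> UNIV \<subseteq> I"
  shows "Zproc n \<in> measurable (PiM I (offspring_measure p)) (count_space UNIV)"
  using assms
proof (induction n)
  case (Suc n)
  have "(\<lambda>w. \<Sum>i<j. w (Suc n, i)) \<in> measurable (PiM I (offspring_measure p)) (count_space UNIV)" for j
  proof (induction j)
    case (Suc j)
    have "(\<lambda>w. w (Suc n, j)) \<in> measurable (PiM I (offspring_measure p)) (count_space UNIV)"
      using Suc.prems \<open>{1..Suc n} \<times> UNIV \<subseteq> I\<close> by (intro measurable_offspring) auto
    then have "(\<lambda>w. m + w (Suc n, j)) \<in> measurable (PiM I (offspring_measure p)) (count_space UNIV)" for m
      by (rule measurable_compose) simp
    then show ?case unfolding sum.lessThan_Suc
      by (rule measurable_compose_countable) (rule Suc.IH)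
  qed simp
  moreover have "Zproc n \<in> measurable (PiM I (offspring_measure p)) (count_space UNIV)"
    by (rule Suc.IH) (use Suc.prems in auto)
  ultimately show ?case unfolding Zproc.simps by (rule measurable_compose_countable)
next
  case 0
  show ?case unfolding Zproc.simps by simp
qed

lemma Zproc_restrict: "{1..n} \<times> UNIV \<subseteq> I \<Longrightarrow> Zproc n (restrict w I) = Zproc n w"
proof (induction n)
  case (Suc n)
  have *: "Zproc n (restrict w I) = Zproc n w" by (rule Suc.IH) (use Suc.prems in auto)
  have "(Suc n, i) \<in> I" for i using Suc.prems by auto
  then show ?case unfolding Zproc.simps * by simp
qed simp

section \<open>One-step identities from the independence of generations\<close>

context
  fixes p :: "nat \<Rightarrow> nat pmf"
begin

interpretation GW: product_prob_space "offspring_measure p" UNIV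
  by (rule product_prob_spaceI) (rule prob_space_offspring_measure)

abbreviation (input) "GW_measure \<equiv> PiM UNIV (offspring_measure p)"

lemma prob_space_GW: "prob_space GW_measure"
  by (rule GW.P.prob_space_axioms)

lemma measurable_Zproc_GW [measurable]: "Zproc n \<in> measurable GW_measure (count_space UNIV)"
  by (rule measurable_Zproc) auto

lemma indep_vars_offspring: "GW.indep_vars (offspring_measure p) (\<lambda>x w. w x) UNIV"
proof (subst GW.indep_vars_iff_distr_eq_PiM)
  show "distr GW_measure GW_measure (\<lambda>w. \<lambda>x\<in>UNIV. w x) = (\<Pi>\<^sub>M x\<in>UNIV. distr GW_measure (offspring_measure p x) (\<lambda>w. w x))"
    by (simp add: GW.PiM_component restrict_UNIV)
qed (auto intro: measurable_component_singleton)

text \<open>Functions composed with \<open>restrict\<close> depend only on their block of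
  coordinates, and disjoint blocks are independent.\<close>

lemma nn_integral_GW_mult:
  assumes "I \<inter> J = {}" 
    and f: "f \<in> borel_measurable (PiM I (offspring_measure p))"
    and g: "g \<in> borel_measurable (PiM J (offspring_measure p))"
  shows "(\<integral>\<^sup>+w. f (restrict w I) * g (restrict w J) \<partial>GW_measure)
     = (\<integral>\<^sup>+w. f (restrict w I) \<partial>GW_measure) * (\<integral>\<^sup>+w. g (restrict w J) \<partial>GW_measure)"
proof -
  have "GW.indep_var (PiM I (offspring_measure p)) (\<lambda>w. restrict w I)
      (PiM J (offspring_measure p)) (\<lambda>w. restrict w J)"
    using GW.indep_var_restrict[OF indep_vars_offspring assms(1)] by simp
  then have "GW.indep_var borel (f \<circ> (\<lambda>w. restrict w I)) borel (g \<circ> (\<lambda>w. restrict w J))"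
    by (rule GW.indep_var_compose) (use f g in auto)
  then have "GW.indep_vars (\<lambda>_. borel)
      (case_bool (\<lambda>w. f (restrict w I)) (\<lambda>w. g (restrict w J))) UNIV"
    unfolding GW.indep_var_def
    by (rule GW.indep_vars_cong[THEN iffD1, rotated -1]) (auto simp: comp_def split: bool.split)
  from GW.indep_vars_nn_integral[OF _ this] show ?thesis by (simp add: UNIV_bool mult.commute)
qed

lemma nn_integral_offspring:
  "(\<integral>\<^sup>+w. f (w (k, i)) \<partial>GW_measure) = (\<integral>\<^sup>+j. f j \<partial>measure_pmf (p k))"
proof -
  have "(\<integral>\<^sup>+j. f j \<partial>distr GW_measure (measure_pmf (p k)) (\<lambda>w. w (k, i))) = (\<integral>\<^sup>+w. f (w (k, i)) \<partial>GW_measure)"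
    by (rule nn_integral_distr) auto
  then show ?thesis using GW.PiM_component[of "(k, i)"] by simp
qed

text \<open>Wald's argument: the random sum becomes an infinite sum over \<open>i\<close> with the
  indicator of \<open>i < Zproc n w\<close>. That indicator and \<open>D\<close> depend on the first
  \<open>n\<close> generations only, while the offspring of individual \<open>i\<close> is a
  coordinate of generation \<open>Suc n\<close>.\<close>

lemma nn_integral_Zproc_step:
  assumes D: "D \<in> sets (PiM ({1..n} \<times> UNIV) (offspring_measure p))"
  shows "(\<integral>\<^sup>+w. indicator D (restrict w ({1..n} \<times> UNIV)) * ennreal (real (Zproc (Suc n) w)) \<partial>GW_measure)
     = (\<integral>\<^sup>+w. indicator D (restrict w ({1..n} \<times> UNIV)) * ennreal (real (Zproc n w)) \<partial>GW_measure)
       * (\<integral>\<^sup>+k. ennreal (real k) \<partial>measure_pmf (p (Suc n)))"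
    (is "?L = ?R * ?m")
proof -
  let ?I = "{1..n} \<times> (UNIV :: nat set)"
  note D [measurable] and measurable_Zproc[of n ?I p, measurable]
  let ?f = "\<lambda>i w. indicator D w * indicator {..<Zproc n w} i :: ennreal"
  have f [measurable]: "?f i \<in> borel_measurable (PiM ?I (offspring_measure p))" for i
    unfolding indicator_def lessThan_iff by measurable
  have r [measurable]: "(\<lambda>w. restrict w ?I) \<in> measurable GW_measure (PiM ?I (offspring_measure p))"
    by (rule measurable_restrict_subset) auto
  have sum: "(\<Sum>i. indicator {..<z} i * g i) = (\<Sum>i<z. g i)" for z and g :: "nat \<Rightarrow> ennreal"
    by (subst suminf_finite[of "{..<z}"]) (auto simp: indicator_def)
  have "?L = (\<integral>\<^sup>+w. (\<Sum>i. ?f i (restrict w ?I) * ennreal (real (w (Suc n, i)))) \<partial>GW_measure)"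
    by (intro nn_integral_cong)
       (simp add: Zproc_restrict sum mult.assoc flip: sum_ennreal)
  also have "\<dots> = (\<Sum>i. \<integral>\<^sup>+w. ?f i (restrict w ?I) * ennreal (real (w (Suc n, i))) \<partial>GW_measure)"
    by (intro nn_integral_suminf borel_measurable_times_ennreal measurable_compose[OF r f]) auto
  also have "\<dots> = (\<Sum>i. (\<integral>\<^sup>+w. ?f i (restrict w ?I) \<partial>GW_measure) * ?m)"
  proof (intro suminf_cong)
    fix i
    have "(\<integral>\<^sup>+w. ?f i (restrict w ?I) * (\<lambda>w. ennreal (real (w (Suc n, i)))) (restrict w {(Suc n, i)}) \<partial>GW_measure)
      = (\<integral>\<^sup>+w. ?f i (restrict w ?I) \<partial>GW_measure) *
        (\<integral>\<^sup>+w. (\<lambda>w. ennreal (real (w (Suc n, i)))) (restrict w {(Suc n, i)}) \<partial>GW_measure)"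
      by (intro nn_integral_GW_mult f) auto
    then show "(\<integral>\<^sup>+w. ?f i (restrict w ?I) * ennreal (real (w (Suc n, i))) \<partial>GW_measure)
        = (\<integral>\<^sup>+w. ?f i (restrict w ?I) \<partial>GW_measure) * ?m"
      using nn_integral_offspring[of "\<lambda>k. ennreal (real k)"] by simp
  qed
  also have "\<dots> = (\<integral>\<^sup>+w. (\<Sum>i. ?f i (restrict w ?I)) \<partial>GW_measure) * ?m"
    by (subst nn_integral_suminf) (simp_all only: ennreal_suminf_multc measurable_compose[OF r f])
  also have "(\<integral>\<^sup>+w. (\<Sum>i. ?f i (restrict w ?I)) \<partial>GW_measure) = ?R"
  proof (intro nn_integral_cong)
    fix w
    have "(\<Sum>i. indicator {..<Zproc n w} i :: ennreal) = (\<Sum>i<Zproc n w. 1)"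
      using sum[of "Zproc n w" "\<lambda>_. 1"] by simp
    then show "(\<Sum>i. ?f i (restrict w ?I)) = indicator D (restrict w ?I) * ennreal (real (Zproc n w))"
      by (simp add: Zproc_restrict ennreal_of_nat_eq_real_of_nat)
  qed
  finally show ?thesis .
qed

text \<open>Given \<open>Zproc n w = j\<close>, the next generation is a sum of \<open>j\<close>
  independent copies, so the offspring generating function is raised to the power
  \<open>j\<close>.\<close>

lemma nn_integral_pgf_step:
  assumes s: "0 \<le> s"
  shows "(\<integral>\<^sup>+w. ennreal (s ^ Zproc (Suc n) w) \<partial>GW_measure)
     = (\<integral>\<^sup>+w. (\<integral>\<^sup>+k. ennreal (s ^ k) \<partial>measure_pmf (p (Suc n))) ^ Zproc n w \<partial>GW_measure)"
proof -
  let ?f = "\<integral>\<^sup>+k. ennreal (s ^ k) \<partial>measure_pmf (p (Suc n))"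
  let ?I = "{1..n} \<times> (UNIV :: nat set)"
  let ?g = "\<lambda>j w. \<Prod>i<j. ennreal (s ^ w (Suc n, i))"
  note measurable_Zproc[of n ?I p, measurable]
  have g [measurable]: "?g j \<in> borel_measurable (PiM ({Suc n} \<times> {..<j}) (offspring_measure p))" for j
  proof (intro borel_measurable_prod_ennreal)
    fix i assume "i \<in> {..<j}"
    then have "(\<lambda>w. w (Suc n, i)) \<in> measurable (PiM ({Suc n} \<times> {..<j}) (offspring_measure p)) (count_space UNIV)"
      by (intro measurable_offspring) auto
    then show "(\<lambda>w. ennreal (s ^ w (Suc n, i))) \<in> borel_measurable (PiM ({Suc n} \<times> {..<j}) (offspring_measure p))"
      by measurable
  qed
  have prod: "(\<integral>\<^sup>+w. ?g j w \<partial>GW_measure) = ?f ^ j" for j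
  proof (induction j)
    case 0
    show ?case by (simp add: GW.P.emeasure_space_1)
  next
    case (Suc j)
    have "(\<integral>\<^sup>+w. ?g j (restrict w ({Suc n} \<times> {..<j})) *
          (\<lambda>w. ennreal (s ^ w (Suc n, j))) (restrict w {(Suc n, j)}) \<partial>GW_measure)
      = (\<integral>\<^sup>+w. ?g j (restrict w ({Suc n} \<times> {..<j})) \<partial>GW_measure) *
        (\<integral>\<^sup>+w. (\<lambda>w. ennreal (s ^ w (Suc n, j))) (restrict w {(Suc n, j)}) \<partial>GW_measure)"
      by (intro nn_integral_GW_mult g) auto
    then show ?case
      using Suc nn_integral_offspring[of "\<lambda>k. ennreal (s ^ k)" "Suc n" j] by (simp add: mult.commute)
  qed
  let ?h = "\<lambda>j w. indicator {j} (Zproc n w) :: ennreal"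
  have h [measurable]: "?h j \<in> borel_measurable (PiM ?I (offspring_measure p))" for j
    unfolding indicator_def singleton_iff by measurable
  have hM [measurable]: "?h j \<in> borel_measurable GW_measure" for j
    unfolding indicator_def singleton_iff by measurable
  \<comment> \<open>Splitting by the value of \<open>Zproc n w\<close> replaces a random index by a
    fixed \<open>j\<close>, for which the independence of blocks can be used.\<close>
  have decomp: "(\<integral>\<^sup>+w. F (Zproc n w) w \<partial>GW_measure) = (\<Sum>j. \<integral>\<^sup>+w. ?h j w * F j w \<partial>GW_measure)"
    if F [measurable]: "\<And>j. F j \<in> borel_measurable GW_measure" for F :: "nat \<Rightarrow> _ \<Rightarrow> ennreal"
  proof -
    have "F (Zproc n w) w = (\<Sum>j. ?h j w * F j w)" for w
      by (subst suminf_finite[of "{Zproc n w}"]) auto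
    then show ?thesis by (simp add: nn_integral_suminf)
  qed
  have gM [measurable]: "?g j \<in> borel_measurable GW_measure" for j
    by (intro borel_measurable_prod_ennreal) measurable
  have "(\<integral>\<^sup>+w. ennreal (s ^ Zproc (Suc n) w) \<partial>GW_measure) = (\<integral>\<^sup>+w. ?g (Zproc n w) w \<partial>GW_measure)"
    using s by (intro nn_integral_cong) (simp add: power_sum prod_ennreal)
  also have "\<dots> = (\<Sum>j. \<integral>\<^sup>+w. ?h j w * ?g j w \<partial>GW_measure)" by (rule decomp) (rule gM)
  also have "\<dots> = (\<Sum>j. \<integral>\<^sup>+w. ?h j w * ?f ^ j \<partial>GW_measure)"
  proof (intro suminf_cong)
    fix j
    have "(\<integral>\<^sup>+w. ?h j (restrict w ?I) * ?g j (restrict w ({Suc n} \<times> {..<j})) \<partial>GW_measure)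
      = (\<integral>\<^sup>+w. ?h j (restrict w ?I) \<partial>GW_measure) * (\<integral>\<^sup>+w. ?g j (restrict w ({Suc n} \<times> {..<j})) \<partial>GW_measure)"
      by (intro nn_integral_GW_mult g h) auto
    then show "(\<integral>\<^sup>+w. ?h j w * ?g j w \<partial>GW_measure) = (\<integral>\<^sup>+w. ?h j w * ?f ^ j \<partial>GW_measure)"
      by (simp add: Zproc_restrict prod nn_integral_multc)
  qed
  also have "\<dots> = (\<integral>\<^sup>+w. ?f ^ Zproc n w \<partial>GW_measure)" by (rule decomp[symmetric]) simp
  finally show ?thesis .
qed

lemma pgf_Zproc_sums:
  assumes s: "0 \<le> s" "s \<le> 1"
  shows "(\<lambda>k. measure GW_measure {w \<in> space GW_measure. Zproc n w = k} * s ^ k) sums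
     enn2real (\<integral>\<^sup>+w. ennreal (s ^ Zproc n w) \<partial>GW_measure)"
proof -
  let ?P = "\<lambda>k. measure GW_measure {w \<in> space GW_measure. Zproc n w = k}"
  have "ennreal (s ^ Zproc n w) = (\<Sum>k. ennreal (s ^ k) * indicator {w \<in> space GW_measure. Zproc n w = k} w)"
    if "w \<in> space GW_measure" for w
    using that by (subst suminf_finite[of "{Zproc n w}"]) auto
  then have "(\<integral>\<^sup>+w. ennreal (s ^ Zproc n w) \<partial>GW_measure)
      = (\<integral>\<^sup>+w. (\<Sum>k. ennreal (s ^ k) * indicator {w \<in> space GW_measure. Zproc n w = k} w) \<partial>GW_measure)"
    by (intro nn_integral_cong) auto
  also have "\<dots> = (\<Sum>k. \<integral>\<^sup>+w. ennreal (s ^ k) * indicator {w \<in> space GW_measure. Zproc n w = k} w \<partial>GW_measure)"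
    by (intro nn_integral_suminf) measurable
  also have "\<dots> = (\<Sum>k. ennreal (?P k * s ^ k))"
    using s by (intro suminf_cong, subst nn_integral_cmult_indicator)
      (auto simp: GW.P.emeasure_eq_measure mult.commute simp flip: ennreal_mult)
  finally have eq: "(\<integral>\<^sup>+w. ennreal (s ^ Zproc n w) \<partial>GW_measure) = (\<Sum>k. ennreal (?P k * s ^ k))" .
  have "(\<integral>\<^sup>+w. ennreal (s ^ Zproc n w) \<partial>GW_measure) \<le> (\<integral>\<^sup>+w. 1 \<partial>GW_measure)"
    using s by (intro nn_integral_mono) (simp add: power_le_one)
  then have "(\<Sum>k. ennreal (?P k * s ^ k)) \<noteq> \<top>"
    unfolding eq by (auto simp: GW.P.emeasure_space_1 top_unique)
  then have sm: "summable (\<lambda>k. ?P k * s ^ k)"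
    using s by (intro summable_suminf_not_top) auto
  then show ?thesis
    unfolding eq using s by (subst suminf_ennreal2) (auto simp: summable_sums suminf_nonneg)
qed

text \<open>Independence concerns the coordinates of the first \<open>n\<close> generations, whereas
  the filtration is generated by the rescaled process. The latter is coarser: its generators lie in
  the sigma-algebra pulled back along \<open>restrict\<close>. The constants \<open>c k\<close>
  stand for the environment products.\<close>

lemma nat_filtration_past:
  assumes "D \<in> sets (nat_filtration GW_measure (\<lambda>k w. c k * real (Zproc k w)) n)"
  shows "\<exists>D'\<in>sets (PiM ({1..n} \<times> UNIV) (offspring_measure p)).
     D = {w \<in> space GW_measure. restrict w ({1..n} \<times> UNIV) \<in> D'}"
proof -
  let ?I = "{1..n} \<times> (UNIV :: nat set)"
  let ?V = "vimage_algebra (space GW_measure) (\<lambda>w. restrict w ?I) (PiM ?I (offspring_measure p))"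
  have V: "sets ?V = {(\<lambda>w. restrict w ?I) -` A \<inter> space GW_measure | A. A \<in> sets (PiM ?I (offspring_measure p))}"
    by (rule sets_vimage_algebra2) (auto simp: space_PiM)
  have gens: "{(\<lambda>w. c k * real (Zproc k w)) -` S \<inter> space GW_measure | k S. k \<le> n \<and> S \<in> sets borel} \<subseteq> sets ?V"
  proof safe
      fix k and S :: "real set" assume k: "k \<le> n" and S [measurable]: "S \<in> sets borel"
    have rest: "Zproc k (restrict w ?I) = Zproc k w" for w
      by (rule Zproc_restrict) (use k in auto)
    have [measurable]: "Zproc k \<in> measurable (PiM ?I (offspring_measure p)) (count_space UNIV)"
      using k by (intro measurable_Zproc) auto
    have "{w \<in> space (PiM ?I (offspring_measure p)). c k * real (Zproc k w) \<in> S}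
        \<in> sets (PiM ?I (offspring_measure p))" (is "?A \<in> _")
      by measurable
    moreover have "(\<lambda>w. c k * real (Zproc k w)) -` S \<inter> space GW_measure = (\<lambda>w. restrict w ?I) -` ?A \<inter> space GW_measure"
      using k by (auto simp: rest space_PiM simp del: One_nat_def)
    ultimately show "(\<lambda>w. c k * real (Zproc k w)) -` S \<inter> space GW_measure \<in> sets ?V"
      unfolding V by blast
  qed
  have "sigma_sets (space GW_measure) {(\<lambda>w. c k * real (Zproc k w)) -` S \<inter> space GW_measure | k S. k \<le> n \<and> S \<in> sets borel}
      \<subseteq> sets ?V"
    using sets.sigma_sets_subset[OF gens] by simp
  moreover have "D \<in> sigma_sets (space GW_measure)
      {(\<lambda>w. c k * real (Zproc k w)) -` S \<inter> space GW_measure | k S. k \<le> n \<and> S \<in> sets borel}"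
    using assms unfolding nat_filtration_def by (subst (asm) sets_measure_of) auto
  ultimately have "D \<in> sets ?V" by blast
  then show ?thesis unfolding V by auto
qed

end

section \<open>The limit law\<close>

text \<open>A coin with success probability \<open>1 / r\<close>, genuine for
  \<open>r \<ge> 1\<close>, selects the component to draw from; as a bind, the mixture is integrated
  component by component.\<close>

definition exp_atom :: "real \<Rightarrow> real measure" where
  "exp_atom r = measure_pmf (bernoulli_pmf (1 / r)) \<bind>
     (\<lambda>c. if c then density lborel (exponential_density (1 / r)) else return borel 0)"

context
  fixes r :: real
  assumes r: "1 \<le> r"
begin

lemma measurable_exp_atom_kernel:
  "(\<lambda>c. if c then density lborel (exponential_density (1 / r)) else return borel 0)
     \<in> measurable (measure_pmf (bernoulli_pmf (1 / r))) (subprob_algebra borel)"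
  using r prob_space_exponential_density[of "1 / r"]
  by (auto simp: space_subprob_algebra prob_space_imp_subprob_space prob_space_return)

lemma sets_exp_atom [simp]: "sets (exp_atom r) = sets borel"
  and space_exp_atom [simp]: "space (exp_atom r) = UNIV"
proof -
  show "sets (exp_atom r) = sets borel"
    unfolding exp_atom_def by (rule sets_bind) (auto intro: sets_kernel[OF measurable_exp_atom_kernel])
  then show "space (exp_atom r) = UNIV" using sets_eq_imp_space_eq by fastforce
qed

lemma nn_integral_exp_atom:
  assumes [measurable]: "f \<in> borel_measurable borel"
  shows "(\<integral>\<^sup>+y. f y \<partial>exp_atom r) = ennreal (1 - 1 / r) * f 0 +
     ennreal (1 / r) * (\<integral>\<^sup>+y. f y \<partial>density lborel (exponential_density (1 / r)))"
  unfolding exp_atom_def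
  using r by (subst nn_integral_bind[OF assms measurable_exp_atom_kernel])
    (simp add: nn_integral_return mult.commute add.commute)

lemma measure_exp_atom:
  assumes [measurable]: "S \<in> sets borel"
  shows "measure (exp_atom r) S = (1 - 1 / r) * indicator S 0 +
     (1 / r) * measure (density lborel (exponential_density (1 / r))) S"
proof -
  interpret X: prob_space "density lborel (exponential_density (1 / r))"
    using r by (intro prob_space_exponential_density) simp
  have "emeasure (exp_atom r) S = (\<integral>\<^sup>+y. indicator S y \<partial>exp_atom r)" by simp
  also have "\<dots> = ennreal (1 - 1 / r) * indicator S 0 +
      ennreal (1 / r) * ennreal (measure (density lborel (exponential_density (1 / r))) S)"
    by (subst nn_integral_exp_atom) (auto simp: X.emeasure_eq_measure)
  also have "\<dots> = ennreal ((1 - 1 / r) * indicator S 0 +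
     (1 / r) * measure (density lborel (exponential_density (1 / r))) S)"
    using r by (simp flip: ennreal_indicator ennreal_mult ennreal_plus)
  finally show ?thesis
    using r by (intro measure_eq_emeasure_eq_ennreal add_nonneg_nonneg mult_nonneg_nonneg) auto
qed

lemma real_distribution_exp_atom: "real_distribution (exp_atom r)"
proof -
  have "emeasure (exp_atom r) UNIV = (\<integral>\<^sup>+y. 1 \<partial>exp_atom r)" by simp
  also have "\<dots> = ennreal (1 - 1 / r) + ennreal (1 / r)"
    using r prob_space.emeasure_space_1[OF prob_space_exponential_density[of "1 / r"]]
    by (subst nn_integral_exp_atom) auto
  also have "\<dots> = 1" using r by (subst ennreal_plus[symmetric]) auto
  finally show ?thesis
    by (intro real_distribution.intro real_distribution_axioms.intro prob_spaceI) auto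
qed

lemma cdf_exp_atom: "cdf (exp_atom r) t = (if 0 \<le> t then 1 - exp (- t / r) / r else 0)"
proof -
  have "emeasure (density lborel (exponential_density (1 / r))) {..t} = erlang_CDF 0 (1 / r) t"
    using r by (intro emeasure_erlang_density) auto
  then have "measure (density lborel (exponential_density (1 / r))) {..t}
      = (if 0 \<le> t then 1 - exp (- t / r) else 0)"
    using r by (simp add: measure_def erlang_CDF_0)
  then show ?thesis
    unfolding cdf_def by (subst measure_exp_atom) (auto simp: right_diff_distrib diff_divide_distrib)
qed

text \<open>The weight \<open>1 / r\<close> cancels the mean \<open>r\<close> of the exponential
  part.\<close>

lemma exp_atom_mean: "(\<integral>\<^sup>+y. ennreal y \<partial>exp_atom r) = 1"
proof -
  have "(\<integral>\<^sup>+y. ennreal y \<partial>density lborel (exponential_density (1 / r)))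
      = (\<integral>\<^sup>+y. ennreal (erlang_density 0 (1 / r) y * y ^ 1) \<partial>lborel)"
    using r by (subst nn_integral_density) (auto simp: ennreal_mult' intro!: nn_integral_cong)
  also have "\<dots> = ennreal r"
    using r by (subst nn_integral_erlang_ith_moment) auto
  finally show ?thesis
    using r by (subst nn_integral_exp_atom) (auto simp flip: ennreal_mult)
qed

end

section \<open>Deterministic limits along the environment\<close>

lemma ln_one_plus_over_self: "((\<lambda>h::real. ln (1 + h) / h) \<longlongrightarrow> 1) (at_right 0)"
proof -
  have "((\<lambda>h. ln (1 + h)) has_real_derivative 1) (at 0)"
    by (auto intro!: derivative_eq_intros)
  then show ?thesis
    by (simp add: has_field_derivative_iff filterlim_at_split)
qed

text \<open>With \<open>h = P n / R n\<close> the base is \<open>1 / (1 + h)\<close>, and for the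
  exponent \<open>j\<close> the logarithm of the power is minus
  \<open>(j * P n) * (ln (1 + h) / h) / R n\<close>. Here \<open>j * P n\<close> tends to
  \<open>t\<close>, the quotient to 1 and \<open>R n\<close> to \<open>r\<close>.\<close>

lemma geometric_tail_limit:
  fixes P R :: "nat \<Rightarrow> real"
  assumes P: "\<And>n. 0 < P n" "P \<longlonglongrightarrow> 0" and R: "R \<longlonglongrightarrow> r" "0 < r" and t: "0 \<le> t"
  shows "(\<lambda>n. (R n / (P n + R n)) ^ nat \<lfloor>t / P n\<rfloor>) \<longlonglongrightarrow> exp (- t / r)"
proof -
  define j where "j n = nat \<lfloor>t / P n\<rfloor>" for n
  \<comment> \<open>\<open>R\<close> may vanish at first, as \<open>R_sum\<close> does at 0, so
    positivity is only eventual.\<close>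
  have Rpos: "\<forall>\<^sub>F n in sequentially. 0 < R n"
    using order_tendstoD(1)[OF R] .
  have jP: "(\<lambda>n. real (j n) * P n) \<longlonglongrightarrow> t"
  proof (rule tendsto_sandwich)
    have "t - P n \<le> real (j n) * P n \<and> real (j n) * P n \<le> t" for n
    proof -
      have "real (j n) = of_int \<lfloor>t / P n\<rfloor>" using t P(1)[of n] by (simp add: j_def)
      then have "real (j n) \<le> t / P n" "t / P n \<le> real (j n) + 1" by linarith+
      then show ?thesis using P(1)[of n] by (simp add: field_simps)
    qed
    then show "\<forall>\<^sub>F n in sequentially. t - P n \<le> real (j n) * P n"
      "\<forall>\<^sub>F n in sequentially. real (j n) * P n \<le> t" by auto
    show "(\<lambda>n. t - P n) \<longlonglongrightarrow> t" using tendsto_diff[OF tendsto_const P(2), of t] by simp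
  qed simp
  have h: "filterlim (\<lambda>n. P n / R n) (at_right 0) sequentially"
    unfolding filterlim_at
  proof
    show "(\<lambda>n. P n / R n) \<longlonglongrightarrow> 0" using tendsto_divide[OF P(2) R(1)] R(2) by simp
    show "\<forall>\<^sub>F n in sequentially. P n / R n \<in> {0<..} \<and> P n / R n \<noteq> 0"
      using Rpos by eventually_elim (use P(1) in \<open>simp add: less_imp_neq[symmetric]\<close>)
  qed
  have "(\<lambda>n. - (real (j n) * P n * (ln (1 + P n / R n) / (P n / R n)) / R n)) \<longlonglongrightarrow> - (t * 1 / r)"
    using R by (intro tendsto_intros jP filterlim_compose[OF ln_one_plus_over_self h]) auto
  then have "(\<lambda>n. exp (- (real (j n) * P n * (ln (1 + P n / R n) / (P n / R n)) / R n))) \<longlonglongrightarrow> exp (- t / r)"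
    by (intro tendsto_exp) simp
  moreover have "\<forall>\<^sub>F n in sequentially. (R n / (P n + R n)) ^ j n
      = exp (- (real (j n) * P n * (ln (1 + P n / R n) / (P n / R n)) / R n))"
    using Rpos
  proof eventually_elim
    case (elim n)
    have pos: "0 < 1 + P n / R n" using elim P(1)[of n] by (simp add: add_pos_pos)
    have "R n / (P n + R n) = inverse (1 + P n / R n)"
      using elim P(1)[of n] by (simp add: field_simps)
    also have "\<dots> = exp (- ln (1 + P n / R n))" using pos by (simp add: exp_minus)
    finally have "(R n / (P n + R n)) ^ j n = exp (real (j n) * - ln (1 + P n / R n))"
      by (simp only: exp_of_nat_mult)
    also have "real (j n) * - ln (1 + P n / R n)
        = - (real (j n) * P n * (ln (1 + P n / R n) / (P n / R n)) / R n)"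
      using elim P(1)[of n] by simp
    finally show ?case .
  qed
  ultimately show ?thesis
    unfolding j_def by (simp add: tendsto_cong)
qed

text \<open>The total downward variation of \<open>P\<close> is at most the sum of \<open>P k * B (Suc k)\<close>, so \<open>P\<close> can only
  fail to vanish in the limit by staying away from 0, and then both series converge together.\<close>

lemma environment_product_tendsto_0:
  fixes A B P :: "nat \<Rightarrow> real"
  assumes P: "\<And>n. 0 < P n" "\<And>n. P (Suc n) = P n * A (Suc n)"
    and B: "\<And>n. 0 < B (Suc n)" and AB: "\<And>n. 1 \<le> A (Suc n) + B (Suc n)"
    and sm: "summable (\<lambda>k. P k * B (Suc k))"
    and nsm: "\<not> summable (\<lambda>k. B (Suc k) / P (Suc k))"
  shows "P \<longlonglongrightarrow> 0"
proof -
  have small: "\<exists>m\<ge>N. P m < e" if "0 < e" for e N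
  proof (rule ccontr)
    assume "\<not> ?thesis"
    then have ge: "e \<le> P m" if "m \<ge> N" for m using that by force
    have "summable (\<lambda>k. B (Suc k) / P (Suc k))"
    proof (rule summable_comparison_test')
      show "summable (\<lambda>k. 1 / (e * e) * (P k * B (Suc k)))" by (rule summable_mult[OF sm])
      fix k assume k: "N \<le> k"
      \<comment> \<open>Both \<open>P k\<close> and \<open>P (Suc k)\<close> are at least
        \<open>e\<close>, whence the square in the comparison.\<close>
      have "B (Suc k) * (e * e) \<le> B (Suc k) * (P k * P (Suc k))"
        using ge k B[of k] \<open>0 < e\<close> by (intro mult_left_mono mult_mono) (auto simp: less_imp_le P(1))
      then show "norm (B (Suc k) / P (Suc k)) \<le> 1 / (e * e) * (P k * B (Suc k))"
        using \<open>0 < e\<close> P(1)[of "Suc k"] B[of k] by (simp add: field_simps)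
    qed
    with nsm show False by simp
  qed
  have drop: "P n \<le> P m + (\<Sum>k=n..<m. P k * B (Suc k))" if "n \<le> m" for n m
    using that
  proof (induction m rule: dec_induct)
    case (step m)
    have "P m * 1 \<le> P m * (A (Suc m) + B (Suc m))"
      using P(1)[of m] AB[of m] by (intro mult_left_mono) auto
    then have "P m \<le> P (Suc m) + P m * B (Suc m)" by (simp add: P(2) ring_distribs)
    then show ?case using step by simp
  qed simp
  show ?thesis
  proof (rule LIMSEQ_I)
    fix e :: real assume "0 < e"
    then obtain N where N: "\<And>m n. m \<ge> N \<Longrightarrow> norm (\<Sum>k=m..<n. P k * B (Suc k)) < e / 2"
      using sm[unfolded summable_Cauchy] by (metis half_gt_zero)
    show "\<exists>N. \<forall>n\<ge>N. norm (P n - 0) < e"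
    proof (intro exI allI impI)
      fix n assume n: "n \<ge> N"
      \<comment> \<open>Compare \<open>n\<close> with a later \<open>m\<close> at which
        \<open>P\<close> is already small: between them \<open>P\<close> drops by at most a block of
        the tail of the convergent series.\<close>
      obtain m where m: "m \<ge> n" "P m < e / 2" using small[of "e / 2" n] \<open>0 < e\<close> by auto
      have "P n < e" using drop[OF m(1)] m(2) N[OF n, of m] by simp
      then show "norm (P n - 0) < e" using P(1)[of n] by simp
    qed
  qed
qed

section \<open>The quenched process\<close>

context
  fixes A B :: "nat \<Rightarrow> 'e \<Rightarrow> real" and x :: 'e
  assumes env: "\<And>k. 1 \<le> k \<Longrightarrow> 0 < A k x \<and> 0 < B k x \<and> 1 \<le> A k x + B k x"
begin

definition R_sum :: "nat \<Rightarrow> real" where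
  "R_sum n = (\<Sum>k<n. Pi_env A x k * B (Suc k) x)"

abbreviation (input) "Q \<equiv> quenched A B x"

lemma Pi_env_0 [simp]: "Pi_env A x 0 = 1"
  and Pi_env_Suc: "Pi_env A x (Suc n) = Pi_env A x n * A (Suc n) x"
  by (simp_all add: Pi_env_def)

lemma Pi_env_pos: "0 < Pi_env A x n"
  unfolding Pi_env_def using env by (intro prod_pos) auto

lemma R_sum_nonneg: "0 \<le> R_sum n"
  unfolding R_sum_def using env Pi_env_pos by (intro sum_nonneg mult_nonneg_nonneg) (auto simp: less_imp_le)

text \<open>The sum starts at 1 and never decreases, because \<open>A + B \<ge> 1\<close> in every
  generation. It is the condition under which \<open>lf_coeff\<close> with these parameters is a
  probability law.\<close>

lemma Pi_env_plus_R_sum: "1 \<le> Pi_env A x n + R_sum n"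
proof (induction n)
  case (Suc n)
  have "Pi_env A x n * 1 \<le> Pi_env A x n * (A (Suc n) x + B (Suc n) x)"
    using env[of "Suc n"] Pi_env_pos[of n] by (intro mult_left_mono) auto
  with Suc show ?case by (simp add: R_sum_def Pi_env_Suc ring_distribs)
qed (simp add: R_sum_def)

text \<open>The outer map belongs to \<open>Zproc n\<close>, the inner one to the offspring law of
  generation \<open>Suc n\<close>, so the induction runs over all \<open>s\<close>. With
  \<open>u = 1 / (1 - s)\<close> the composition reads
  \<open>Pi_env A x n * (A (Suc n) x * u + B (Suc n) x) + R_sum n\<close>, whose slope and intercept
  are the parameters at \<open>Suc n\<close>.\<close>

lemma quenched_pgf:
  assumes "0 \<le> s" "s \<le> 1"
  shows "(\<integral>\<^sup>+w. ennreal (s ^ Zproc n w) \<partial>Q) =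
     ennreal (1 - (1 - s) / (Pi_env A x n + R_sum n * (1 - s)))"
  using assms
proof (induction n arbitrary: s)
  case 0
  interpret prob_space Q unfolding quenched_def by (rule prob_space_GW)
  show ?case by (simp add: R_sum_def emeasure_space_1)
next
  case (Suc n)
  let ?a = "A (Suc n) x" and ?b = "B (Suc n) x"
  have ab: "0 < ?a" "0 \<le> ?b" "1 \<le> ?a + ?b" using env[of "Suc n"] by auto
  define f where "f = 1 - (1 - s) / (?a + ?b * (1 - s))"
  have D: "0 < ?a + ?b * (1 - s)" using ab Suc.prems by (simp add: add_pos_nonneg)
  \<comment> \<open>The induction hypothesis is applied at \<open>f\<close>; here
    \<open>A + B \<ge> 1\<close> ensures \<open>0 \<le> f\<close>.\<close>
  have "(1 - s) * 1 \<le> (1 - s) * (?a + ?b)" using ab Suc.prems by (intro mult_left_mono) auto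
  also have "\<dots> \<le> ?a + ?b * (1 - s)" using ab Suc.prems by (simp add: ring_distribs)
  finally have f: "0 \<le> f" "f \<le> 1" using D Suc.prems by (auto simp: f_def)
  have "(\<integral>\<^sup>+w. ennreal (s ^ Zproc (Suc n) w) \<partial>Q) = (\<integral>\<^sup>+w. ennreal f ^ Zproc n w \<partial>Q)"
    unfolding quenched_def f_def using Suc.prems ab
    by (subst nn_integral_pgf_step) (simp_all add: nn_integral_LF_pgf)
  also have "\<dots> = (\<integral>\<^sup>+w. ennreal (f ^ Zproc n w) \<partial>Q)" using f by (simp add: ennreal_power)
  also have "\<dots> = ennreal (1 - (1 - f) / (Pi_env A x n + R_sum n * (1 - f)))"
    by (rule Suc.IH) (use f in auto)
  also have "(1 - f) / (Pi_env A x n + R_sum n * (1 - f)) =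
      (1 - s) / (Pi_env A x (Suc n) + R_sum (Suc n) * (1 - s))"
  proof -
    have "Pi_env A x n + R_sum n * (1 - f) =
        (Pi_env A x (Suc n) + R_sum (Suc n) * (1 - s)) / (?a + ?b * (1 - s))"
    proof -
      have "Pi_env A x n + R_sum n * (1 - f) =
          (Pi_env A x n * (?a + ?b * (1 - s)) + R_sum n * (1 - s)) / (?a + ?b * (1 - s))"
        using D by (simp add: f_def add_divide_distrib)
      also have "Pi_env A x n * (?a + ?b * (1 - s)) + R_sum n * (1 - s) =
          Pi_env A x (Suc n) + R_sum (Suc n) * (1 - s)"
        by (simp add: R_sum_def Pi_env_Suc ring_distribs)
      finally show ?thesis .
    qed
    then show ?thesis using D by (simp add: f_def)
  qed
  finally show ?case .
qed

lemma Zproc_law: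
  "measure Q {w \<in> space Q. Zproc n w = k} = lf_coeff (Pi_env A x n) (R_sum n) k"
proof -
  have "(\<lambda>k. measure Q {w \<in> space Q. Zproc n w = k}) = lf_coeff (Pi_env A x n) (R_sum n)"
  proof (rule powser_coeff_unique)
    fix s :: real assume s: "0 \<le> s" "s < 1"
    let ?F = "1 - (1 - s) / (Pi_env A x n + R_sum n * (1 - s))"
    show "(\<lambda>k. lf_coeff (Pi_env A x n) (R_sum n) k * s ^ k) sums ?F"
      by (rule lf_coeff_sums[OF Pi_env_pos R_sum_nonneg Pi_env_plus_R_sum]) (use s in auto)
    then have "0 \<le> ?F"
      by (rule sums_le[OF _ sums_zero, rotated])
         (use lf_coeff_nonneg[OF Pi_env_pos R_sum_nonneg Pi_env_plus_R_sum] s in auto)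
    then show "(\<lambda>k. measure Q {w \<in> space Q. Zproc n w = k} * s ^ k) sums ?F"
      using pgf_Zproc_sums[of s "\<lambda>k. LF (A k x) (B k x)" n] quenched_pgf[of s n] s
      unfolding quenched_def by simp
  qed
  then show ?thesis by (rule fun_cong)
qed

interpretation Q: prob_space Q
  unfolding quenched_def by (rule prob_space_GW)

lemma measurable_Zproc_quenched [measurable]: "Zproc n \<in> measurable Q (count_space UNIV)"
  unfolding quenched_def by measurable

lemma measurable_Wproc_quenched [measurable]: "Wproc A x n \<in> borel_measurable Q"
  unfolding Wproc_def by measurable

lemma Zproc_cdf:
  "measure Q {w \<in> space Q. Zproc n w \<le> j} = 1 - 1 / (Pi_env A x n + R_sum n) *
     (R_sum n / (Pi_env A x n + R_sum n)) ^ j"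
proof -
  have "measure Q {w \<in> space Q. Zproc n w \<le> j} = measure Q (\<Union>k\<in>{..j}. {w \<in> space Q. Zproc n w = k})"
    by (rule arg_cong[where f="measure Q"]) auto
  also have "\<dots> = (\<Sum>k\<le>j. measure Q {w \<in> space Q. Zproc n w = k})"
    by (intro Q.finite_measure_finite_Union) (auto simp: disjoint_family_on_def)
  also have "\<dots> = 1 - 1 / (Pi_env A x n + R_sum n) * (R_sum n / (Pi_env A x n + R_sum n)) ^ j"
    unfolding Zproc_law by (rule sum_lf_coeff[OF Pi_env_pos R_sum_nonneg Pi_env_plus_R_sum])
  finally show ?thesis .
qed

lemma Wproc_nonneg: "0 \<le> Wproc A x n w"
  unfolding Wproc_def using Pi_env_pos[of n] by simp

lemma Wproc_cdf:
  assumes "0 \<le> t"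
  shows "measure Q {w \<in> space Q. Wproc A x n w \<le> t} = 1 - 1 / (Pi_env A x n + R_sum n) *
     (R_sum n / (Pi_env A x n + R_sum n)) ^ nat \<lfloor>t / Pi_env A x n\<rfloor>"
proof -
  have "Wproc A x n w \<le> t \<longleftrightarrow> Zproc n w \<le> nat \<lfloor>t / Pi_env A x n\<rfloor>" for w
  proof -
    have "Wproc A x n w \<le> t \<longleftrightarrow> real (Zproc n w) \<le> t / Pi_env A x n"
      using Pi_env_pos[of n] by (simp add: Wproc_def pos_le_divide_eq mult.commute)
    also have "\<dots> \<longleftrightarrow> int (Zproc n w) \<le> \<lfloor>t / Pi_env A x n\<rfloor>" by (simp add: le_floor_iff)
    also have "\<dots> \<longleftrightarrow> Zproc n w \<le> nat \<lfloor>t / Pi_env A x n\<rfloor>"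
      using assms Pi_env_pos[of n] by (subst nat_le_eq_zle[symmetric]) auto
    finally show ?thesis .
  qed
  then show ?thesis using Zproc_cdf by simp
qed

text \<open>Nonnegative integrals are used because integrability is not yet available; taking
  \<open>D\<close> to be the whole space yields mean one, from which integrability follows.\<close>

lemma Wproc_step:
  assumes "D \<in> sets (nat_filtration Q (Wproc A x) n)"
  shows "(\<integral>\<^sup>+w. indicator D w * ennreal (Wproc A x (Suc n) w) \<partial>Q)
     = (\<integral>\<^sup>+w. indicator D w * ennreal (Wproc A x n w) \<partial>Q)"
proof -
  let ?p = "\<lambda>k. LF (A k x) (B k x)" and ?I = "{1..n} \<times> (UNIV :: nat set)"
  have [measurable]: "(\<lambda>w. restrict w ?I) \<in> measurable Q (PiM ?I (offspring_measure ?p))"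
    unfolding quenched_def by (rule measurable_restrict_subset) auto
  have "D \<in> sets (nat_filtration (GW_measure ?p) (\<lambda>k w. Pi_env A x k * real (Zproc k w)) n)"
    using assms by (simp add: quenched_def Wproc_def[abs_def])
  from nat_filtration_past[OF this] obtain D' where
    D' [measurable]: "D' \<in> sets (PiM ?I (offspring_measure ?p))"
    and D: "D = {w \<in> space Q. restrict w ?I \<in> D'}"
    unfolding quenched_def by blast
  have W: "(\<integral>\<^sup>+w. indicator D w * ennreal (Wproc A x m w) \<partial>Q) = ennreal (Pi_env A x m) *
      (\<integral>\<^sup>+w. indicator D' (restrict w ?I) * ennreal (real (Zproc m w)) \<partial>Q)" for m
    using Pi_env_pos[of m]
    by (subst nn_integral_cmult[symmetric])
       (auto intro!: nn_integral_cong simp: D Wproc_def indicator_def ennreal_mult' simp del: One_nat_def)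
  have "(\<integral>\<^sup>+w. indicator D' (restrict w ?I) * ennreal (real (Zproc (Suc n) w)) \<partial>Q)
      = (\<integral>\<^sup>+w. indicator D' (restrict w ?I) * ennreal (real (Zproc n w)) \<partial>Q) * ennreal (1 / A (Suc n) x)"
    using nn_integral_Zproc_step[OF D'] nn_integral_LF_mean[of "A (Suc n) x" "B (Suc n) x"] env[of "Suc n"]
    by (simp add: quenched_def)
  moreover have "ennreal (Pi_env A x (Suc n)) * ennreal (1 / A (Suc n) x) = ennreal (Pi_env A x n)"
    using env[of "Suc n"] Pi_env_pos[of n] by (simp add: Pi_env_Suc flip: ennreal_mult)
  ultimately show ?thesis
    unfolding W by (simp only: mult.assoc[symmetric] mult.commute)
qed

lemma nn_integral_Wproc: "(\<integral>\<^sup>+w. ennreal (Wproc A x n w) \<partial>Q) = 1"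
proof (induction n)
  case 0
  show ?case by (simp add: Wproc_def Q.emeasure_space_1)
next
  case (Suc n)
  have mem: "space Q \<in> sets (nat_filtration Q (Wproc A x) n)"
    unfolding nat_filtration_def by (subst sets_measure_of) (auto intro: sigma_sets_top)
  have "(\<integral>\<^sup>+w. indicator (space Q) w * ennreal (Wproc A x m w) \<partial>Q)
      = (\<integral>\<^sup>+w. ennreal (Wproc A x m w) \<partial>Q)" for m
    by (intro nn_integral_cong) simp
  then show ?case using Wproc_step[OF mem] Suc.IH by simp
qed

lemma integrable_Wproc: "integrable Q (Wproc A x n)"
  by (rule integrableI_nonneg) (auto simp: Wproc_nonneg nn_integral_Wproc)

lemma integral_Wproc: "integral\<^sup>L Q (Wproc A x n) = 1"
  by (subst integral_eq_nn_integral) (auto simp: Wproc_nonneg nn_integral_Wproc)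

lemma sets_nat_filtration_Wproc:
  "sets (nat_filtration Q (Wproc A x) n) =
     sigma_sets (space Q) {Wproc A x k -` S \<inter> space Q | k S. k \<le> n \<and> S \<in> sets borel}"
  unfolding nat_filtration_def by (rule sets_measure_of) auto

lemma subalgebra_nat_filtration: "subalgebra Q (nat_filtration Q (Wproc A x) n)"
  unfolding subalgebra_def
proof
  show "space (nat_filtration Q (Wproc A x) n) = space Q"
    unfolding nat_filtration_def by (rule space_measure_of) auto
  show "sets (nat_filtration Q (Wproc A x) n) \<subseteq> sets Q"
    unfolding sets_nat_filtration_Wproc
    by (rule sets.sigma_sets_subset) (auto intro: measurable_sets)
qed

lemma martingale_Wproc: "martingale Q (nat_filtration Q (Wproc A x)) (Wproc A x)"
  unfolding martingale_def
proof (intro conjI allI impI)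
  let ?F = "nat_filtration Q (Wproc A x)"
  show sub: "subalgebra Q (?F n)" for n by (rule subalgebra_nat_filtration)
  show "sets (?F n) \<subseteq> sets (?F m)" if "n \<le> m" for n m
    unfolding sets_nat_filtration_Wproc using that
    by (intro sigma_sets_mono') (blast intro: order_trans)
  show ad: "Wproc A x n \<in> borel_measurable (?F n)" for n
  proof (rule measurableI)
    fix S :: "real set" assume "S \<in> sets borel"
    moreover have "space (?F n) = space Q" using sub[of n] by (simp add: subalgebra_def)
    ultimately show "Wproc A x n -` S \<inter> space (?F n) \<in> sets (?F n)"
      unfolding sets_nat_filtration_Wproc by (auto intro!: sigma_sets.Basic)
  qed simp
  show "integrable Q (Wproc A x n)" for n by (rule integrable_Wproc)
  show "AE w in Q. real_cond_exp Q (?F n) (Wproc A x (Suc n)) w = Wproc A x n w" for n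
  proof -
    interpret F: finite_measure_subalgebra Q "?F n"
      by unfold_locales (rule sub)
    show ?thesis
    proof (rule F.real_cond_exp_charact[OF _ integrable_Wproc integrable_Wproc ad])
      fix D assume D: "D \<in> sets (?F n)"
      then have [measurable]: "D \<in> sets Q" using sub by (auto simp: subalgebra_def)
      have "(\<integral>w\<in>D. Wproc A x m w \<partial>Q) = enn2real (\<integral>\<^sup>+w. indicator D w * ennreal (Wproc A x m w) \<partial>Q)" for m
        unfolding set_lebesgue_integral_def
        by (subst integral_eq_nn_integral)
           (auto simp: Wproc_nonneg ennreal_mult' ennreal_indicator)
      then show "(\<integral>w\<in>D. Wproc A x (Suc n) w \<partial>Q) = (\<integral>w\<in>D. Wproc A x n w \<partial>Q)"
        using Wproc_step[OF D] by simp
    qed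
  qed
qed

section \<open>Passage to the limit in a supercritical environment\<close>

context
  assumes summ: "summable (\<lambda>k. Pi_env A x k * B (Suc k) x)"
    and not_summ: "\<not> summable (\<lambda>k. B (Suc k) x / Pi_env A x (Suc k))"
begin

lemma Pi_env_tendsto_0: "Pi_env A x \<longlonglongrightarrow> 0"
  by (rule environment_product_tendsto_0[where A="\<lambda>k. A k x" and B="\<lambda>k. B k x"])
     (use env Pi_env_pos Pi_env_Suc summ not_summ in auto)

lemma R_sum_tendsto: "R_sum \<longlonglongrightarrow> R_inf A B x"
  using summable_LIMSEQ[OF summ] by (simp add: R_sum_def[abs_def] R_inf_def)

text \<open>Makes \<open>1 / R_inf A B x\<close> a probability. The bound on
  \<open>Pi_env A x n + R_sum n\<close> survives in the limit, where the first summand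
  disappears.\<close>

lemma R_inf_ge_1: "1 \<le> R_inf A B x"
proof (rule LIMSEQ_le_const)
  show "(\<lambda>n. Pi_env A x n + R_sum n) \<longlonglongrightarrow> R_inf A B x"
    using tendsto_add[OF Pi_env_tendsto_0 R_sum_tendsto] by simp
qed (use Pi_env_plus_R_sum in blast)

lemma Wproc_cdf_tendsto:
  assumes "0 \<le> t"
  shows "(\<lambda>n. measure Q {w \<in> space Q. Wproc A x n w \<le> t}) \<longlonglongrightarrow> cdf (exp_atom (R_inf A B x)) t"
proof -
  have "(\<lambda>n. 1 - 1 / (Pi_env A x n + R_sum n) *
     (R_sum n / (Pi_env A x n + R_sum n)) ^ nat \<lfloor>t / Pi_env A x n\<rfloor>)
     \<longlonglongrightarrow> 1 - 1 / (0 + R_inf A B x) * exp (- t / R_inf A B x)"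
    using R_inf_ge_1 assms
    by (intro tendsto_intros geometric_tail_limit Pi_env_pos Pi_env_tendsto_0 R_sum_tendsto) auto
  then show ?thesis
    using Wproc_cdf[OF assms] cdf_exp_atom[OF R_inf_ge_1] assms by simp
qed

text \<open>The distribution function is squeezed: the open half-line above \<open>t\<close> bounds
  it from below, the open half-lines below \<open>t' > t\<close> bound it from above by the target
  at \<open>t'\<close>, and right continuity brings \<open>t'\<close> down to \<open>t\<close>. This
  covers the atom at 0 as well.\<close>

lemma distr_limit_Wproc:
  assumes [measurable]: "W \<in> borel_measurable Q"
    and lim: "AE w in Q. (\<lambda>n. Wproc A x n w) \<longlonglongrightarrow> W w"
  shows "distr Q borel W = exp_atom (R_inf A B x)"
proof (rule cdf_unique)
  let ?G = "cdf (exp_atom (R_inf A B x))"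
  show "real_distribution (exp_atom (R_inf A B x))"
    by (rule real_distribution_exp_atom[OF R_inf_ge_1])
  show "real_distribution (distr Q borel W)" by (rule Q.real_distribution_distr) simp
  have cdfW: "cdf (distr Q borel W) t = measure Q {w \<in> space Q. W w \<le> t}" for t
    unfolding cdf_def by (subst measure_distr) (auto intro!: arg_cong[where f="measure Q"])
  have compl: "measure Q {w \<in> space Q. t < Y w} = 1 - measure Q {w \<in> space Q. Y w \<le> t}"
    if [measurable]: "Y \<in> borel_measurable Q" for Y :: "_ \<Rightarrow> real" and t
    using Q.prob_neg[of "\<lambda>w. Y w \<le> t"] by (simp add: not_le)
  show "cdf (distr Q borel W) = ?G"
  proof
    fix t
    show "cdf (distr Q borel W) t = ?G t"
    proof (cases "0 \<le> t")
      case False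
      have "AE w in Q. 0 \<le> W w"
        using lim by eventually_elim (rule LIMSEQ_le_const, auto simp: Wproc_nonneg)
      then have "AE w in Q. \<not> W w \<le> t" by eventually_elim (use False in auto)
      then have "measure Q {w \<in> space Q. W w \<le> t} = 0"
        by (subst Q.prob_eq_0) auto
      then show ?thesis using False by (simp add: cdfW cdf_exp_atom[OF R_inf_ge_1])
    next
      case True
      have "measure Q {w \<in> space Q. W w \<in> {t<..}} \<le> 1 - ?G t"
        by (rule Q.measure_open_le_limit[OF _ _ lim, where u="\<lambda>n. measure Q {w \<in> space Q. t < Wproc A x n w}"])
           (use True in \<open>auto simp: compl intro!: tendsto_intros Wproc_cdf_tendsto\<close>)
      then have lower: "?G t \<le> cdf (distr Q borel W) t" by (simp add: compl cdfW)
      have "cdf (distr Q borel W) t \<le> ?G t'" if "t < t'" for t'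
      proof -
        have "measure Q {w \<in> space Q. W w \<in> {..<t'}} \<le> ?G t'"
          by (rule Q.measure_open_le_limit[OF _ _ lim, where u="\<lambda>n. measure Q {w \<in> space Q. Wproc A x n w \<le> t'}"])
             (use True that in \<open>auto intro!: Wproc_cdf_tendsto Q.finite_measure_mono\<close>)
        moreover have "measure Q {w \<in> space Q. W w \<le> t} \<le> measure Q {w \<in> space Q. W w \<in> {..<t'}}"
          using that by (intro Q.finite_measure_mono) auto
        ultimately show ?thesis by (simp add: cdfW)
      qed
      then have "\<forall>\<^sub>F t' in at_right t. cdf (distr Q borel W) t \<le> ?G t'"
        by (intro eventually_at_rightI[of t "t + 1"]) auto
      moreover have "(?G \<longlongrightarrow> ?G t) (at_right t)"
        using finite_borel_measure.cdf_is_right_cont[OF real_distribution.finite_borel_measure_M[OF real_distribution_exp_atom[OF R_inf_ge_1]]]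
        by (simp add: continuous_within)
      ultimately have "cdf (distr Q borel W) t \<le> ?G t"
        by (intro tendsto_lowerbound[of ?G]) auto
      with lower show ?thesis by simp
    qed
  qed
qed

lemma Wproc_limit:
  "\<exists>W. W \<in> borel_measurable Q \<and> (AE w in Q. (\<lambda>n. Wproc A x n w) \<longlonglongrightarrow> W w) \<and>
     (\<forall>S\<in>sets borel. measure Q {w \<in> space Q. W w \<in> S}
        = (1 - 1 / R_inf A B x) * indicator S 0
          + (1 / R_inf A B x) * measure (density lborel (exponential_density (1 / R_inf A B x))) S) \<and>
     integrable Q W \<and> integral\<^sup>L Q W = 1"
proof (intro exI conjI ballI)
  \<comment> \<open>\<open>lim\<close> has a value even where the sequence diverges, so the witness
    is measurable on the whole space; the divergence set is null.\<close>
  let ?W = "\<lambda>w. lim (\<lambda>n. Wproc A x n w)"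
  show [measurable]: "?W \<in> borel_measurable Q" by measurable
  show lim: "AE w in Q. (\<lambda>n. Wproc A x n w) \<longlonglongrightarrow> ?W w"
    using Q.nonneg_martingale_converges[OF martingale_Wproc Wproc_nonneg]
    by eventually_elim (simp add: convergent_LIMSEQ_iff)
  note law = distr_limit_Wproc[OF _ lim, simplified]
  show "measure Q {w \<in> space Q. ?W w \<in> S}
        = (1 - 1 / R_inf A B x) * indicator S 0
          + (1 / R_inf A B x) * measure (density lborel (exponential_density (1 / R_inf A B x))) S"
    if [measurable]: "S \<in> sets borel" for S
  proof -
    have "measure Q {w \<in> space Q. ?W w \<in> S} = measure (distr Q borel ?W) S"
      by (subst measure_distr) (auto intro!: arg_cong[where f="measure Q"])
    then show ?thesis by (simp add: law measure_exp_atom[OF R_inf_ge_1])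
  qed
  have nonneg: "AE w in Q. 0 \<le> ?W w"
    using lim by eventually_elim (rule LIMSEQ_le_const, auto simp: Wproc_nonneg)
  \<comment> \<open>The mean is computed by transport to the law; Fatou's lemma alone would only
    bound it by one.\<close>
  have "(\<integral>\<^sup>+w. ennreal (?W w) \<partial>Q) = (\<integral>\<^sup>+y. ennreal y \<partial>distr Q borel ?W)"
    by (subst nn_integral_distr) auto
  then have nn: "(\<integral>\<^sup>+w. ennreal (?W w) \<partial>Q) = 1"
    by (simp add: law exp_atom_mean[OF R_inf_ge_1])
  show "integrable Q ?W" by (rule integrableI_nonneg) (use nn nonneg in auto)
  show "integral\<^sup>L Q ?W = 1" by (subst integral_eq_nn_integral) (use nn nonneg in auto)
qed

end

end

theorem theorem4p2:
  fixes E :: "'e measure" and A B :: "nat \<Rightarrow> 'e \<Rightarrow> real"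
  assumes "prob_space E"
    and iid_indep: "prob_space.indep_vars E (\<lambda>_. borel) (\<lambda>n x. (A n x, B n x)) {1..}"
    and iid_dist: "\<And>n. n \<ge> 1 \<Longrightarrow>
        distr E borel (\<lambda>x. (A n x, B n x)) = distr E borel (\<lambda>x. (A 1 x, B 1 x))"
    and support: "\<And>n. n \<ge> 1 \<Longrightarrow> AE x in E. A n x > 0 \<and> B n x > 0 \<and> A n x + B n x \<ge> 1"
    and R_fin: "AE x in E. summable (\<lambda>k. Pi_env A x k * B (Suc k) x)"
    and Rinv_inf: "AE x in E. \<not> summable (\<lambda>k. B (Suc k) x / Pi_env A x (Suc k))"
  shows "AE x in E.
     martingale (quenched A B x) (nat_filtration (quenched A B x) (Wproc A x)) (Wproc A x)
   \<and> (\<forall>n w. 0 \<le> Wproc A x n w)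
   \<and> (\<forall>n. integral\<^sup>L (quenched A B x) (Wproc A x n) = 1)
   \<and> (\<exists>Winf. Winf \<in> borel_measurable (quenched A B x)
        \<and> (AE w in quenched A B x. (\<lambda>n. Wproc A x n w) \<longlonglongrightarrow> Winf w)
        \<and> (\<forall>S\<in>sets borel.
              measure (quenched A B x) {w \<in> space (quenched A B x). Winf w \<in> S}
              = (1 - 1 / R_inf A B x) * indicator S 0
                + (1 / R_inf A B x) * measure (density lborel (exponential_density (1 / R_inf A B x))) S)
        \<and> integrable (quenched A B x) Winf
        \<and> integral\<^sup>L (quenched A B x) Winf = 1)"
proof -
  \<comment> \<open>Countably many conditions hold off a single null set; from then on the
    environment is fixed.\<close>
  have "AE x in E. \<forall>n\<in>{1..}. A n x > 0 \<and> B n x > 0 \<and> A n x + B n x \<ge> 1"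
    using support by (subst AE_ball_countable) auto
  with R_fin Rinv_inf show ?thesis
  proof eventually_elim
    case (elim x)
    then have env: "0 < A k x \<and> 0 < B k x \<and> 1 \<le> A k x + B k x" if "1 \<le> k" for k
      using that by auto
    show ?case
      using martingale_Wproc[of A x B, OF env] Wproc_nonneg[of A x B, OF env] integral_Wproc[of A x B, OF env]
        Wproc_limit[of A x B, OF env elim(1,2)]
      by blast
  qed
qed

end
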